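(* Let $d \ge 1$ and let $\phi : \mathbb{R}^d \to \mathbb{R}$ be a convex and Lipschitz continuous function. For $\eta, \alpha > 0$ denote $$\Sigma_{\eta,\alpha} = \{ x \in \mathbb{R}^d \mid \mathrm{diam}(\partial\phi(B(x,\eta))) \geq \alpha\}, \qquad \Sigma_\alpha = \{ x\in \mathbb{R}^d \mid \mathrm{diam}(\partial\phi(x)) \geq \alpha\}.$$ Then, for all $R > 0$, $\alpha > 0$ and $\eta>0$, $$ \mathcal{N}(\Sigma_{\eta,\alpha} \cap B(0,R), 8\eta) \leq c_{d,R,\eta}\, \frac{\mathrm{Lip}(\phi)}{\alpha\, \eta^{d-1}}, \qquad \text{with } c_{d,R,\eta} = 48\, d^2 (R+4\eta)^{d-1}.$$ In particular, there exists a constant $c_d$ depending only on the dimension $d$ such that for all such $\phi$ and all $R, \alpha > 0$, $$ \mathcal{H}^{d-1}(\Sigma_\alpha\cap B(0,R))\leq c_d\, \frac{\mathrm{Lip}(\phi)\, R^{d-1}}{\alpha}. $$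
   Context: $\|\cdot\|$ is the Euclidean norm on $\mathbb{R}^d$ and $B(x,r)$ is the open Euclidean ball of center $x$ and radius $r$. $\mathrm{Lip}(\phi)$ is the Lipschitz constant of $\phi$ on $\mathbb{R}^d$. For $x \in \mathbb{R}^d$, $\partial\phi(x) = \{ g \in \mathbb{R}^d \mid \phi(y) \ge \phi(x) + \langle g | y - x\rangle \ \forall y \in \mathbb{R}^d\}$ is the subdifferential of $\phi$ at $x$, and for a set $A \subset \mathbb{R}^d$, $\partial \phi(A) = \bigcup_{x \in A} \partial\phi(x)$. $\mathrm{diam}$ denotes the Euclidean diameter of a set. For a bounded set $K \subset \mathbb{R}^d$ and $\delta > 0$, $\mathcal{N}(K,\delta)$ is the minimum number of balls of radius $\delta$ needed to cover $K$. $\mathcal{H}^{d-1}$ is the $(d-1)$-dimensional Hausdorff measure. *)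

theory Defs
  imports "HOL-Analysis.Analysis"
begin

definition subdifferential :: "('a::real_inner \<Rightarrow> real) \<Rightarrow> 'a \<Rightarrow> 'a set" where
  "subdifferential f x = {g. \<forall>y. f y \<ge> f x + g \<bullet> (y - x)}"

definition subdifferential_on :: "('a::real_inner \<Rightarrow> real) \<Rightarrow> 'a set \<Rightarrow> 'a set" where
  "subdifferential_on f A = (\<Union>x\<in>A. subdifferential f x)"

text \<open>Meaningful for Lipschitz functions only; otherwise the infimum is over the empty set.\<close>

definition Lip :: "('a::metric_space \<Rightarrow> 'b::metric_space) \<Rightarrow> real" where
  "Lip f = Inf {L. L-lipschitz_on UNIV f}"

text \<open>
  The library's \<^const>\<open>diameter\<close> is real-valued and hence meaningful on bounded sets only.
  All sets it is applied to in the next two definitions are bounded when the function is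
  Lipschitz, see \<open>bounded_subdifferential_on\<close> below.
\<close>

definition Sigma_scale :: "('a::real_inner \<Rightarrow> real) \<Rightarrow> real \<Rightarrow> real \<Rightarrow> 'a set" where
  "Sigma_scale f \<eta> \<alpha> = {x. diameter (subdifferential_on f (ball x \<eta>)) \<ge> \<alpha>}"

definition Sigma_set :: "('a::real_inner \<Rightarrow> real) \<Rightarrow> real \<Rightarrow> 'a set" where
  "Sigma_set f \<alpha> = {x. diameter (subdifferential f x) \<ge> \<alpha>}"

text \<open>
  Open balls, with centres anywhere in the space.  The minimum exists for bounded sets in
  Euclidean spaces, see \<open>covering_number_attained\<close> below.
\<close>

definition covering_number :: "'a::metric_space set \<Rightarrow> real \<Rightarrow> nat" where
  "covering_number K \<delta> = (LEAST n. \<exists>C. finite C \<and> card C = n \<and> K \<subseteq> (\<Union>x\<in>C. ball x \<delta>))"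

text \<open>
  The \<open>k\<close>-dimensional Hausdorff measure, for integral \<open>k\<close>, with the usual normalisation
  \<open>\<omega>\<^sub>k / 2\<^sup>k\<close> (\<open>\<omega>\<^sub>k\<close> the volume of the \<open>k\<close>-dimensional unit ball) that makes it agree with
  Lebesgue measure on \<open>k\<close>-dimensional Euclidean space.  For \<open>k = 0\<close> a nonempty set has
  weight \<open>1\<close>, since \<open>0 ^ 0 = 1\<close>, whereas the empty set must have weight \<open>0\<close>; so this
  case gives the counting measure.  Empty members make finite covers instances of the
  sequences used here.
\<close>

definition hausdorff_weight :: "nat \<Rightarrow> 'a::metric_space set \<Rightarrow> ennreal" where
  "hausdorff_weight k U =
     (if U = {} then 0 else ennreal (unit_ball_vol (real k) / 2 ^ k * diameter U ^ k))"

definition hausdorff_premeasure :: "nat \<Rightarrow> real \<Rightarrow> 'a::metric_space set \<Rightarrow> ennreal" where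
  "hausdorff_premeasure k \<delta> A =
     Inf {(\<Sum>i. hausdorff_weight k (U i)) | U :: nat \<Rightarrow> 'a set.
            A \<subseteq> (\<Union>i. U i) \<and> (\<forall>i. bounded (U i) \<and> diameter (U i) \<le> \<delta>)}"

definition hausdorff_measure :: "nat \<Rightarrow> 'a::metric_space set \<Rightarrow> ennreal" where
  "hausdorff_measure k A = (SUP \<delta>\<in>{0<..}. hausdorff_premeasure k \<delta> A)"

lemma bounded_subdifferential_on:
  fixes f :: "'a::real_inner \<Rightarrow> real"
  assumes "L-lipschitz_on UNIV f"
  shows "bounded (subdifferential_on f A)"
proof -
  have "norm g \<le> L" if g: "g \<in> subdifferential f x" for g x
  proof (cases "g = 0")
    case True
    then show ?thesis using lipschitz_on_nonneg[OF assms] by simp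
  next
    case False
    have "f (x + g) \<ge> f x + g \<bullet> (x + g - x)"
      using g unfolding subdifferential_def by blast
    moreover have "dist (f (x + g)) (f x) \<le> L * dist (x + g) x"
      using lipschitz_onD[OF assms] by blast
    ultimately have "norm g * norm g \<le> L * norm g"
      by (simp add: dist_norm dot_square_norm power2_eq_square)
    then show ?thesis using False by simp
  qed
  then show ?thesis
    unfolding subdifferential_on_def bounded_iff by blast
qed

lemma covering_number_attained:
  fixes K :: "'a::euclidean_space set"
  assumes "bounded K" and "\<delta> > 0"
  shows "\<exists>C. finite C \<and> card C = covering_number K \<delta> \<and> K \<subseteq> (\<Union>x\<in>C. ball x \<delta>)"
proof -
  have "compact (closure K)" using assms(1) by (simp add: compact_closure)
  then obtain C where "finite C" "closure K \<subseteq> (\<Union>x\<in>C. ball x \<delta>)"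
    using compact_imp_seq_compact seq_compact_imp_totally_bounded assms(2) by metis
  then have "\<exists>n C. finite C \<and> card C = n \<and> K \<subseteq> (\<Union>x\<in>C. ball x \<delta>)"
    using closure_subset by blast
  then show ?thesis
    unfolding covering_number_def by (rule LeastI_ex)
qed

end

theory Submission
  imports Defs "HOL-Real_Asymp.Real_Asymp"
begin

text \<open>
  The Laplacian of a convex function is a nonnegative measure.  On a ball of radius \<open>s\<close> its mass
  is at most the area of the sphere times the Lipschitz constant, hence of order
  \<open>L * s ^ (d - 1)\<close>.  Near a point of \<open>Sigma_scale \<phi> \<eta> \<alpha>\<close> the slope of \<open>\<phi>\<close> changes by
  \<open>\<alpha>\<close> within the distance \<open>\<eta>\<close>, which forces a mass of order \<open>\<alpha> * \<eta> ^ (d - 1)\<close>.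
  Balls of radius \<open>4 * \<eta>\<close> around points at mutual distance at least \<open>8 * \<eta>\<close> are disjoint,
  so there are at most about \<open>L * (R + 4 * \<eta>) ^ (d - 1) / (\<alpha> * \<eta> ^ (d - 1))\<close> such points,
  and a maximal set of them gives the cover.  The Hausdorff measure of \<open>Sigma_set \<phi> \<alpha>\<close>, which
  is contained in all the sets \<open>Sigma_scale \<phi> \<eta> \<alpha>\<close>, is estimated with these covers as
  \<open>\<eta>\<close> tends to zero.

  To make this precise without second derivatives, and with explicit constants, the Laplacian of
  \<open>\<phi>\<close> is paired with the squares of the weights
  \<open>w \<mapsto> max 0 (r\<^sup>2 - (norm (w - c))\<^sup>2)\<close>.  Two integrations by parts turn this pairing into four
  times an integral of \<open>\<phi>\<close> itself, called \<open>flux\<close> below; a single one turns it into an integral of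
  radial derivatives of \<open>\<phi>\<close>.  Both identities are limits of difference quotients
  (\<open>laplace_diff_bump_square_tendsto\<close> and \<open>radial_diff_tendsto\<close>), in which the quotients fall on
  an explicit weight and \<open>\<phi>\<close> needs only be continuous.  The first identity makes the flux monotone
  in the weight, so that fluxes over disjoint balls add up to at most a multiple of the flux over a
  large ball (\<open>sum_flux_le\<close>).  The second one bounds the flux from above by the Lipschitz constant
  (\<open>flux_le_lipschitz\<close>) and from below by the distance of two subgradients at nearby points
  (\<open>flux_ge_subgradients\<close>).  The few moments of the ball that enter the constants follow from the
  same two identities, applied to homogeneous functions.
\<close>

section \<open>Integration over Euclidean space\<close>

lemma integrable_continuous_support:
  fixes f :: "'a::euclidean_space \<Rightarrow> real"
  assumes "continuous_on UNIV f" and "\<And>w. norm w > r \<Longrightarrow> f w = 0"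
  shows "integrable lborel f"
proof -
  have "integrable lborel (\<lambda>w. indicator (cball 0 r) w *\<^sub>R f w)"
    using assms(1) by (intro borel_integrable_compact) (auto intro: continuous_on_subset)
  moreover have "(\<lambda>w. indicator (cball 0 r) w *\<^sub>R f w) = f"
    using assms(2) by (auto simp: indicator_def fun_eq_iff not_le)
  ultimately show ?thesis by simp
qed

lemma set_integrable_ball:
  fixes f :: "'a::euclidean_space \<Rightarrow> real"
  assumes "continuous_on UNIV f"
  shows "set_integrable lborel (ball c r) f"
proof (rule set_integrable_subset)
  show "set_integrable lborel (cball c r) f"
    unfolding set_integrable_def
    using assms by (intro borel_integrable_compact) (auto intro: continuous_on_subset)
qed auto

lemma lborel_integral_translate:
  fixes f :: "'a::euclidean_space \<Rightarrow> real"
  assumes "f \<in> borel_measurable borel"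
  shows "(LINT w|lborel. f (c + w)) = (LINT w|lborel. f w)"
proof -
  have "(LINT w|lborel. f w) = (LINT w|distr lborel borel ((+) c). f w)"
    by (simp add: lborel_distr_plus)
  also have "\<dots> = (LINT w|lborel. f (c + w))"
    using assms by (subst integral_distr) auto
  finally show ?thesis by simp
qed

lemma lborel_integral_scale:
  fixes f :: "'a::euclidean_space \<Rightarrow> real"
  assumes [measurable]: "f \<in> borel_measurable borel" and "a \<noteq> 0"
  shows "(LINT w|lborel. f w) = \<bar>a\<bar> ^ DIM('a) * (LINT w|lborel. f (a *\<^sub>R w))"
proof -
  have "(LINT w|lborel. f w)
    = (LINT w|density (distr lborel borel (\<lambda>w. 0 + a *\<^sub>R w)) (\<lambda>_. \<bar>a\<bar> ^ DIM('a)). f w)"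
    by (subst lborel_affine[OF assms(2), of 0]) simp
  also have "\<dots> = \<bar>a\<bar> ^ DIM('a) * (LINT w|lborel. f (a *\<^sub>R w))"
    by (subst integral_density) (auto simp: integral_distr)
  finally show ?thesis .
qed

section \<open>The weight and the flux\<close>

text \<open>
  The curvature of a convex function is tested against the square of this weight.  The square
  vanishes to second order on the sphere of radius \<open>r\<close>, so its second differences are
  of second order uniformly in space, and the computations of its Laplacian below are instances
  of dominated convergence.
\<close>

definition bump :: "real \<Rightarrow> 'a::real_inner \<Rightarrow> real" where
  "bump r w = max 0 (r\<^sup>2 - (norm w)\<^sup>2)"

lemma bump_nonneg: "0 \<le> bump r w"
  and bump_le: "bump r w \<le> r\<^sup>2"
  by (auto simp: bump_def)

lemma bump_eq_0: "norm w \<ge> r \<Longrightarrow> 0 \<le> r \<Longrightarrow> bump r w = 0"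
  by (simp add: bump_def power_mono)

lemma bump_inside: "norm w \<le> r \<Longrightarrow> bump r w = r\<^sup>2 - (norm w)\<^sup>2"
  by (simp add: bump_def power_mono)

lemma bump_uminus [simp]: "bump r (- w) = bump r w"
  by (simp add: bump_def)

lemma continuous_on_bump [continuous_intros]:
  "continuous_on A f \<Longrightarrow> continuous_on A (\<lambda>x. bump r (f x))"
  unfolding bump_def by (intro continuous_intros)

text \<open>
  For smooth \<open>f\<close> this is the integral of \<open>\<nabla>f w \<bullet> w\<close> against \<open>bump r w\<close>,
  integrated by parts once more: the second factor is minus the divergence of
  \<open>w \<mapsto> bump r w *\<^sub>R w\<close>, and it is also a quarter of the Laplacian of the square of
  \<open>bump r\<close>.  The first reading gives bounds for the flux, the second one its monotonicity in the
  weight for convex \<open>f\<close>.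
\<close>

definition flux :: "('a::euclidean_space \<Rightarrow> real) \<Rightarrow> real \<Rightarrow> real" where
  "flux f r = (LINT w:ball 0 r|lborel. f w * ((real DIM('a) + 2) * (norm w)\<^sup>2 - real DIM('a) * r\<^sup>2))"

section \<open>The Laplacian paired with the weight\<close>

text \<open>
  For a convex function every summand is nonnegative, for each step \<open>t\<close>; so a pairing with
  a larger weight is larger already before the limit \<open>t \<rightarrow> 0\<close>.
\<close>

definition laplace_diff :: "real \<Rightarrow> ('a::euclidean_space \<Rightarrow> real) \<Rightarrow> 'a \<Rightarrow> real" where
  "laplace_diff t f w = (\<Sum>b\<in>Basis. (f (w + t *\<^sub>R b) + f (w - t *\<^sub>R b) - 2 * f w) / t\<^sup>2)"

lemma continuous_shift:
  fixes f :: "'a::real_normed_vector \<Rightarrow> real"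
  assumes "continuous_on UNIV f"
  shows "continuous_on A (\<lambda>w. f (c + w))" "continuous_on A (\<lambda>w. f (w + c))" "continuous_on A (\<lambda>w. f (w - c))"
    "continuous_on A (\<lambda>w. f (a *\<^sub>R w))"
  by (auto intro!: continuous_on_compose2[OF assms] continuous_intros)

lemma continuous_on_laplace_diff:
  assumes "continuous_on UNIV f"
  shows "continuous_on A (laplace_diff t f)"
  unfolding laplace_diff_def divide_inverse
  by (intro continuous_intros continuous_shift[OF assms] continuous_on_subset[OF assms]) auto

text \<open>
  Since Lebesgue measure is translation invariant, each shift can be moved from one factor to
  the other, where it becomes the opposite shift; the second difference is symmetric in the two.
\<close>

lemma laplace_diff_adjoint:
  fixes f g :: "'a::euclidean_space \<Rightarrow> real"
  assumes f: "continuous_on UNIV f" and g: "continuous_on UNIV g"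
    and supp: "\<And>w. norm w > r \<Longrightarrow> g w = 0"
  shows "(LINT w|lborel. g w * laplace_diff t f w) = (LINT w|lborel. f w * laplace_diff t g w)"
proof -
  note cont = continuous_shift[OF f] continuous_shift[OF g]
    continuous_on_subset[OF f] continuous_on_subset[OF g]
  have int1: "integrable lborel (\<lambda>w. g w * f (w + h))" for h :: 'a
    by (rule integrable_continuous_support[of _ r]) (auto intro!: continuous_intros cont simp: supp)
  have int2: "integrable lborel (\<lambda>w. f w * g (w + h))" for h :: 'a
  proof (rule integrable_continuous_support[of _ "r + norm h"])
    fix w :: 'a assume "norm w > r + norm h"
    then have "norm (w + h) > r" using norm_triangle_ineq4[of "w + h" h] by simp
    then show "f w * g (w + h) = 0" by (simp add: supp)
  qed (auto intro!: continuous_intros cont)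
  have shift: "(LINT w|lborel. g w * f (w + h)) = (LINT w|lborel. f w * g (w - h))" for h :: 'a
  proof -
    have "(LINT w|lborel. f w * g (w - h)) = (LINT w|lborel. f (h + w) * g (h + w - h))"
      by (rule lborel_integral_translate[symmetric])
        (intro borel_measurable_continuous_onI continuous_intros cont; simp)
    then show ?thesis by (simp add: mult.commute add.commute)
  qed
  have expand: "(LINT w|lborel. u w * laplace_diff t v w)
    = (\<Sum>b\<in>Basis. ((LINT w|lborel. u w * v (w + t *\<^sub>R b)) + (LINT w|lborel. u w * v (w - t *\<^sub>R b))
        - 2 * (LINT w|lborel. u w * v w)) / t\<^sup>2)"
    if int: "\<And>h. integrable lborel (\<lambda>w. u w * v (w + h))" for u v :: "'a \<Rightarrow> real"
  proof -
    have int_minus: "integrable lborel (\<lambda>w. u w * v (w - h))" for h using int[of "- h"] by simp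
    have int_zero: "integrable lborel (\<lambda>w. u w * v w)" using int[of 0] by simp
    have "(LINT w|lborel. u w * laplace_diff t v w)
      = (LINT w|lborel. (\<Sum>b\<in>Basis. (u w * v (w + t *\<^sub>R b) + u w * v (w - t *\<^sub>R b) - 2 * (u w * v w)) / t\<^sup>2))"
      by (simp add: laplace_diff_def sum_distrib_left algebra_simps)
    also have "\<dots> = (\<Sum>b\<in>Basis. LINT w|lborel. (u w * v (w + t *\<^sub>R b) + u w * v (w - t *\<^sub>R b) - 2 * (u w * v w)) / t\<^sup>2)"
      by (intro Bochner_Integration.integral_sum integrable_divide_zero Bochner_Integration.integrable_diff
          Bochner_Integration.integrable_add integrable_mult_right int int_minus int_zero)
    also have "\<dots> = (\<Sum>b\<in>Basis. ((LINT w|lborel. u w * v (w + t *\<^sub>R b)) + (LINT w|lborel. u w * v (w - t *\<^sub>R b))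
        - 2 * (LINT w|lborel. u w * v w)) / t\<^sup>2)"
      by (simp add: int int_minus int_zero)
    finally show ?thesis .
  qed
  show ?thesis
    unfolding expand[OF int1] expand[OF int2] using shift[of "- t *\<^sub>R _"] shift[of 0]
    by (intro sum.cong) (auto simp: shift add.commute)
qed

text \<open>
  The square of the positive part is continuously differentiable with a Lipschitz derivative, so
  its first-order expansion has a quadratic error also where the sign of the argument changes.
\<close>

lemma positive_part_square_taylor:
  fixes a \<delta> :: real
  shows "\<bar>(max 0 (a + \<delta>))\<^sup>2 - (max 0 a)\<^sup>2 - 2 * max 0 a * \<delta>\<bar> \<le> \<delta>\<^sup>2"
proof -
  have *: "\<bar>- a\<^sup>2 - 2 * a * \<delta>\<bar> \<le> \<delta>\<^sup>2" if "a \<ge> 0" "a + \<delta> \<le> 0"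
  proof -
    have "0 \<le> (a+\<delta>)\<^sup>2" by simp
    moreover have "a * (a + \<delta>) \<le> 0" "\<delta> * (a + \<delta>) \<ge> 0" "a * (-\<delta>) \<ge> 0"
      using that by (auto intro: mult_nonneg_nonpos mult_nonpos_nonpos simp: zero_le_mult_iff mult_le_0_iff)
    ultimately show ?thesis by (simp add: power2_eq_square algebra_simps abs_le_iff)
  qed
  have **: "(a + \<delta>)\<^sup>2 \<le> \<delta>\<^sup>2" if "a \<le> 0" "a + \<delta> \<ge> 0"
    using that by (intro power_mono) auto
  show ?thesis
  proof (cases "a \<ge> 0")
    case True
    then show ?thesis
      using * by (cases "a + \<delta> \<ge> 0") (auto simp: power2_sum)
  next
    case False
    then show ?thesis
      using ** by (cases "a + \<delta> \<ge> 0") auto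
  qed
qed

lemma norm_add_sq: "(norm (w + h))\<^sup>2 = (norm w)\<^sup>2 + 2 * (w \<bullet> h) + (norm h)\<^sup>2"
  and norm_diff_sq: "(norm (w - h))\<^sup>2 = (norm w)\<^sup>2 - 2 * (w \<bullet> h) + (norm h)\<^sup>2"
  for w h :: "'a::real_inner"
  by (simp_all add: power2_norm_eq_inner inner_add inner_diff inner_commute)

text \<open>
  The squared norms at \<open>w + h\<close> and \<open>w - h\<close> differ from the one at \<open>w\<close> by opposite
  linear terms, which cancel in the first-order part of the expansion, up to a term of order
  \<open>(norm h)\<^sup>2\<close>.
\<close>

lemma bump_square_second_difference:
  fixes w h :: "'a::real_inner"
  shows "\<bar>(bump r (w + h))\<^sup>2 + (bump r (w - h))\<^sup>2 - 2 * (bump r w)\<^sup>2\<bar>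
    \<le> 4 * r\<^sup>2 * (norm h)\<^sup>2 + 2 * (2 * norm w * norm h + (norm h)\<^sup>2)\<^sup>2"
proof -
  define a where "a = r\<^sup>2 - (norm w)\<^sup>2"
  define d1 where "d1 = - 2 * (w \<bullet> h) - (norm h)\<^sup>2"
  define d2 where "d2 = 2 * (w \<bullet> h) - (norm h)\<^sup>2"
  have b: "bump r w = max 0 a" "bump r (w + h) = max 0 (a + d1)" "bump r (w - h) = max 0 (a + d2)"
    by (simp_all add: bump_def a_def d1_def d2_def norm_add_sq norm_diff_sq)
  have wh: "\<bar>w \<bullet> h\<bar> \<le> norm w * norm h" by (rule Cauchy_Schwarz_ineq2)
  define M where "M = 2 * norm w * norm h + (norm h)\<^sup>2"
  have "\<bar>d1\<bar> \<le> \<bar>M\<bar>" "\<bar>d2\<bar> \<le> \<bar>M\<bar>"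
    using wh zero_le_power2[of "norm h"] unfolding d1_def d2_def M_def by linarith+
  then have sq: "d1\<^sup>2 \<le> M\<^sup>2" "d2\<^sup>2 \<le> M\<^sup>2" by (simp_all add: abs_le_square_iff)
  have lin: "2 * max 0 a * d1 + 2 * max 0 a * d2 = - 4 * (max 0 a * (norm h)\<^sup>2)"
    by (simp add: d1_def d2_def algebra_simps)
  have bd: "max 0 a * (norm h)\<^sup>2 \<le> r\<^sup>2 * (norm h)\<^sup>2" "0 \<le> max 0 a * (norm h)\<^sup>2"
    by (auto simp: a_def intro!: mult_right_mono)
  have combine: "\<bar>A1 + A2 - 2 * A0\<bar> \<le> 4 * y + 2 * m"
    if "\<bar>A1 - A0 - p1\<bar> \<le> q1" "\<bar>A2 - A0 - p2\<bar> \<le> q2" "q1 \<le> m" "q2 \<le> m" "p1 + p2 = - 4 * z" "z \<le> y" "0 \<le> z"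
    for A0 A1 A2 p1 p2 q1 q2 m y z :: real
    using that by linarith
  show ?thesis
    using combine[OF positive_part_square_taylor positive_part_square_taylor sq lin bd]
    unfolding b M_def by (simp only: mult.assoc)
qed

lemma lborel_AE_not_sphere:
  fixes c :: "'a::euclidean_space"
  shows "AE w in lborel. norm (w - c) \<noteq> r"
proof -
  have "sphere c r \<in> null_sets lborel"
    using negligible_sphere[of c r] by (simp add: negligible_iff_null_sets null_sets_completion_iff)
  then have "AE w in lborel. w \<notin> sphere c r" by (rule AE_not_in)
  then show ?thesis by eventually_elim (auto simp: dist_norm norm_minus_commute)
qed

lemma laplace_diff_bump_square_inside:
  fixes w :: "'a::euclidean_space"
  assumes "norm w + \<bar>t\<bar> \<le> r" and "t \<noteq> 0"
  shows "laplace_diff t (\<lambda>w. (bump r w)\<^sup>2) w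
    = 4 * ((real DIM('a) + 2) * (norm w)\<^sup>2 - real DIM('a) * r\<^sup>2) + 2 * real DIM('a) * t\<^sup>2"
proof -
  have "((bump r (w + t *\<^sub>R b))\<^sup>2 + (bump r (w - t *\<^sub>R b))\<^sup>2 - 2 * (bump r w)\<^sup>2) / t\<^sup>2
    = 8 * (w \<bullet> b)\<^sup>2 - 4 * (r\<^sup>2 - (norm w)\<^sup>2) + 2 * t\<^sup>2" if b: "b \<in> Basis" for b
  proof -
    have nb: "norm (t *\<^sub>R b) = \<bar>t\<bar>" using b by simp
    have "norm (w + t *\<^sub>R b) \<le> r" "norm (w - t *\<^sub>R b) \<le> r" "norm w \<le> r"
      using assms norm_triangle_ineq[of w "t *\<^sub>R b"] norm_triangle_ineq4[of w "t *\<^sub>R b"] nb by linarith+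
    then have "(bump r (w + t *\<^sub>R b))\<^sup>2 + (bump r (w - t *\<^sub>R b))\<^sup>2 - 2 * (bump r w)\<^sup>2
       = (8 * (w \<bullet> b)\<^sup>2 - 4 * (r\<^sup>2 - (norm w)\<^sup>2) + 2 * t\<^sup>2) * t\<^sup>2"
      unfolding bump_inside[OF \<open>norm (w + t *\<^sub>R b) \<le> r\<close>] bump_inside[OF \<open>norm (w - t *\<^sub>R b) \<le> r\<close>]
        bump_inside[OF \<open>norm w \<le> r\<close>] norm_add_sq norm_diff_sq nb power2_abs inner_scaleR_right
      by algebra
    then show ?thesis using assms(2) by simp
  qed
  then have "laplace_diff t (\<lambda>w. (bump r w)\<^sup>2) w
    = (\<Sum>b\<in>Basis. 8 * (w \<bullet> b)\<^sup>2 - 4 * (r\<^sup>2 - (norm w)\<^sup>2) + 2 * t\<^sup>2)"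
    by (simp add: laplace_diff_def)
  also have "\<dots> = 8 * (\<Sum>b\<in>Basis. (w \<bullet> b)\<^sup>2) + real DIM('a) * (2 * t\<^sup>2 - 4 * (r\<^sup>2 - (norm w)\<^sup>2))"
    by (simp add: sum.distrib sum_subtractf sum_distrib_left algebra_simps)
  also have "(\<Sum>b\<in>Basis. (w \<bullet> b)\<^sup>2) = (norm w)\<^sup>2"
    unfolding power2_norm_eq_inner by (subst euclidean_inner) (simp add: power2_eq_square)
  finally show ?thesis by (simp add: algebra_simps)
qed

lemma laplace_diff_bump_square_outside:
  fixes w :: "'a::euclidean_space"
  assumes "norm w \<ge> r + \<bar>t\<bar>" and "r \<ge> 0"
  shows "laplace_diff t (\<lambda>w. (bump r w)\<^sup>2) w = 0"
proof -
  have "bump r (w + t *\<^sub>R b) = 0" "bump r (w - t *\<^sub>R b) = 0" "bump r w = 0" if b: "b \<in> Basis" for b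
  proof -
    have nb: "norm (t *\<^sub>R b) = \<bar>t\<bar>" using b by simp
    have "norm (w + t *\<^sub>R b) \<ge> r" "norm (w - t *\<^sub>R b) \<ge> r" "norm w \<ge> r"
      using assms norm_triangle_ineq4[of "w + t *\<^sub>R b" "t *\<^sub>R b"] norm_triangle_ineq[of "w - t *\<^sub>R b" "t *\<^sub>R b"] nb
      unfolding add_diff_cancel diff_add_cancel by linarith+
    then show "bump r (w + t *\<^sub>R b) = 0" "bump r (w - t *\<^sub>R b) = 0" "bump r w = 0"
      using assms(2) by (simp_all add: bump_eq_0)
  qed
  then show ?thesis by (simp add: laplace_diff_def)
qed

lemma laplace_diff_bump_square_bound:
  fixes w :: "'a::euclidean_space"
  assumes "r \<ge> 0" and t: "0 < t" "t \<le> 1"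
  shows "\<bar>laplace_diff t (\<lambda>w. (bump r w)\<^sup>2) w\<bar>
    \<le> real DIM('a) * (4 * r\<^sup>2 + 2 * (2 * (r + 1) + 1)\<^sup>2) * indicator (cball 0 (r + 1)) w"
proof (cases "norm w \<le> r + 1")
  case True
  have "\<bar>((bump r (w + t *\<^sub>R b))\<^sup>2 + (bump r (w - t *\<^sub>R b))\<^sup>2 - 2 * (bump r w)\<^sup>2) / t\<^sup>2\<bar>
      \<le> 4 * r\<^sup>2 + 2 * (2 * (r + 1) + 1)\<^sup>2" if b: "b \<in> Basis" for b
  proof -
    have nb: "norm (t *\<^sub>R b) = t" using b t by simp
    have "2 * norm w * t + t\<^sup>2 \<le> (2 * (r + 1) + 1) * t"
    proof -
      have "2 * norm w * t \<le> 2 * (r + 1) * t" "t * t \<le> 1 * t"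
        using True t by (auto intro!: mult_right_mono)
      then show ?thesis by (simp add: power2_eq_square algebra_simps)
    qed
    then have "(2 * norm w * t + t\<^sup>2)\<^sup>2 \<le> ((2 * (r + 1) + 1) * t)\<^sup>2"
      using t by (intro power_mono) auto
    then have "4 * r\<^sup>2 * t\<^sup>2 + 2 * (2 * norm w * t + t\<^sup>2)\<^sup>2 \<le> (4 * r\<^sup>2 + 2 * (2 * (r + 1) + 1)\<^sup>2) * t\<^sup>2"
      unfolding power_mult_distrib[of _ t] distrib_right[of "4 * r\<^sup>2"] by simp
    then have "\<bar>(bump r (w + t *\<^sub>R b))\<^sup>2 + (bump r (w - t *\<^sub>R b))\<^sup>2 - 2 * (bump r w)\<^sup>2\<bar>
      \<le> (4 * r\<^sup>2 + 2 * (2 * (r + 1) + 1)\<^sup>2) * t\<^sup>2"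
      using bump_square_second_difference[of r w "t *\<^sub>R b"] unfolding nb by linarith
    then show ?thesis using t by (simp add: pos_divide_le_eq)
  qed
  then have "\<bar>laplace_diff t (\<lambda>w. (bump r w)\<^sup>2) w\<bar> \<le> (\<Sum>b\<in>(Basis::'a set). 4 * r\<^sup>2 + 2 * (2 * (r + 1) + 1)\<^sup>2)"
    unfolding laplace_diff_def by (intro order_trans[OF sum_abs] sum_mono) auto
  then show ?thesis using True by simp
next
  case False
  then show ?thesis using laplace_diff_bump_square_outside[of r t w] assms by simp
qed

text \<open>
  The difference quotients move from \<open>f\<close> to the weight, where they converge off the sphere
  to four times the factor that defines the flux.
\<close>

lemma laplace_diff_bump_square_tendsto:
  fixes f :: "'a::euclidean_space \<Rightarrow> real"
  assumes f: "continuous_on UNIV f" and r: "r > 0"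
  shows "(\<lambda>n. LINT w|lborel. (bump r w)\<^sup>2 * laplace_diff (1 / real (Suc n)) f w) \<longlonglongrightarrow> 4 * flux f r"
proof -
  define t where "t n = 1 / real (Suc n)" for n
  have t: "0 < t n" "t n \<le> 1" for n by (auto simp: t_def)
  have t0: "t \<longlonglongrightarrow> 0" unfolding t_def by real_asymp
  define g where "g w = (bump r w)\<^sup>2" for w :: 'a
  have g: "continuous_on A g" for A unfolding g_def by (intro continuous_intros)
  define D where "D w = 4 * ((real DIM('a) + 2) * (norm w)\<^sup>2 - real DIM('a) * r\<^sup>2)" for w :: 'a
  have meas [measurable]: "f \<in> borel_measurable borel" "D \<in> borel_measurable borel"
    unfolding D_def by (intro borel_measurable_continuous_onI continuous_intros f)+
  have lim: "(\<lambda>n. laplace_diff (t n) g w) \<longlonglongrightarrow> indicator (ball 0 r) w * D w" if w: "norm w \<noteq> r" for w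
  proof (cases "norm w < r")
    case True
    have "(\<lambda>n. D w + 2 * real DIM('a) * (t n)\<^sup>2) \<longlonglongrightarrow> D w + 2 * real DIM('a) * 0\<^sup>2"
      by (intro tendsto_intros t0)
    moreover have "eventually (\<lambda>n. t n < r - norm w) sequentially"
      using t0 True by (intro order_tendstoD) auto
    then have "eventually (\<lambda>n. D w + 2 * real DIM('a) * (t n)\<^sup>2 = laplace_diff (t n) g w) sequentially"
    proof eventually_elim
      case (elim n)
      then show ?case using t[of n] unfolding g_def D_def
        by (subst laplace_diff_bump_square_inside) auto
    qed
    ultimately show ?thesis using True by (simp add: tendsto_cong)
  next
    case False
    then have "norm w > r" using w by simp
    then have "eventually (\<lambda>n. t n < norm w - r) sequentially"
      using t0 by (intro order_tendstoD) auto
    then have "eventually (\<lambda>n. laplace_diff (t n) g w = 0) sequentially"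
    proof eventually_elim
      case (elim n)
      then show ?case using t[of n] r unfolding g_def
        by (subst laplace_diff_bump_square_outside) auto
    qed
    then show ?thesis using False by (simp add: tendsto_eventually)
  qed
  have "(\<lambda>n. LINT w|lborel. f w * laplace_diff (t n) g w)
    \<longlonglongrightarrow> (LINT w|lborel. f w * (indicator (ball 0 r) w * D w))"
  proof (rule integral_dominated_convergence[where
        w = "\<lambda>w. indicator (cball 0 (r + 1)) w *\<^sub>R (\<bar>f w\<bar> * (real DIM('a) * (4 * r\<^sup>2 + 2 * (2 * (r + 1) + 1)\<^sup>2)))"])
    show "(\<lambda>w. f w * (indicator (ball 0 r) w * D w)) \<in> borel_measurable lborel"
      by (intro borel_measurable_times borel_measurable_indicator) (use meas in simp_all)
    show "(\<lambda>w. f w * laplace_diff (t n) g w) \<in> borel_measurable lborel" for n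
      by (auto intro!: borel_measurable_continuous_onI continuous_intros f continuous_on_laplace_diff g)
    show "integrable lborel (\<lambda>w. indicator (cball 0 (r + 1)) w *\<^sub>R
        (\<bar>f w\<bar> * (real DIM('a) * (4 * r\<^sup>2 + 2 * (2 * (r + 1) + 1)\<^sup>2))))"
      using f by (intro borel_integrable_compact) (auto intro!: continuous_intros continuous_on_subset[OF f])
    show "AE w in lborel. (\<lambda>n. f w * laplace_diff (t n) g w) \<longlonglongrightarrow> f w * (indicator (ball 0 r) w * D w)"
      using lborel_AE_not_sphere[of 0 r] by eventually_elim (auto intro!: tendsto_mult lim)
    show "AE w in lborel. norm (f w * laplace_diff (t n) g w)
      \<le> indicator (cball 0 (r + 1)) w *\<^sub>R (\<bar>f w\<bar> * (real DIM('a) * (4 * r\<^sup>2 + 2 * (2 * (r + 1) + 1)\<^sup>2)))" for n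
    proof (rule AE_I2)
      fix w
      have "\<bar>f w\<bar> * \<bar>laplace_diff (t n) g w\<bar>
        \<le> \<bar>f w\<bar> * (real DIM('a) * (4 * r\<^sup>2 + 2 * (2 * (r + 1) + 1)\<^sup>2) * indicator (cball 0 (r + 1)) w)"
        unfolding g_def using r t by (intro mult_left_mono laplace_diff_bump_square_bound) auto
      then show "norm (f w * laplace_diff (t n) g w)
      \<le> indicator (cball 0 (r + 1)) w *\<^sub>R (\<bar>f w\<bar> * (real DIM('a) * (4 * r\<^sup>2 + 2 * (2 * (r + 1) + 1)\<^sup>2)))"
        by (simp add: abs_mult mult_ac)
    qed
  qed
  moreover have "(LINT w|lborel. f w * laplace_diff (t n) g w) = (LINT w|lborel. g w * laplace_diff (t n) f w)" for n
    by (rule laplace_diff_adjoint[OF f g, of r, symmetric]) (use r in \<open>simp add: g_def bump_eq_0\<close>)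
  moreover have "(LINT w|lborel. f w * (indicator (ball 0 r) w * D w)) = 4 * flux f r"
    unfolding flux_def set_lebesgue_integral_def D_def integral_mult_right_zero[symmetric]
    by (rule Bochner_Integration.integral_cong) (auto simp: mult_ac)
  ultimately show ?thesis by (simp add: g_def t_def)
qed

section \<open>The flux as a dilation derivative\<close>

definition radial_diff :: "real \<Rightarrow> ('a::real_vector \<Rightarrow> real) \<Rightarrow> 'a \<Rightarrow> real" where
  "radial_diff t f w = (f ((1 + t) *\<^sub>R w) - f w) / t"

text \<open>
  The radial derivative of \<open>f\<close>, integrated against the weight, is the flux.  A change of
  variables replaces the dilation of \<open>f\<close> by a dilation of the explicit weight, so \<open>f\<close>
  needs only be continuous.  One-sided bounds on radial difference quotients, as they come with
  convexity or with a Lipschitz constant, thereby turn into bounds on the flux.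
\<close>

lemma radial_diff_tendsto:
  fixes f :: "'a::euclidean_space \<Rightarrow> real"
  assumes f: "continuous_on UNIV f" and r: "r > 0"
  shows "(\<lambda>n. LINT w|lborel. radial_diff (1 / real (Suc n)) f w * bump r w) \<longlonglongrightarrow> flux f r"
proof -
  define d where "d = DIM('a)"
  define t where "t n = 1 / real (Suc n)" for n
  define m where "m n = 1 / (1 + t n)" for n
  have t: "0 < t n" "t n \<le> 1" for n by (auto simp: t_def)
  have m: "0 < m n" "m n < 1" "1 - m n \<le> t n" "m n * (1 + t n) = 1" "1/2 \<le> m n" for n
    using t[of n] by (auto simp: m_def field_simps)
  have m6: "(m n - 1) / t n = - m n" for n
  proof -
    have "m n - 1 = - m n * t n" using m(4)[of n] by (simp add: algebra_simps)
    then show ?thesis using t(1)[of n] by simp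
  qed
  have m1: "m \<longlonglongrightarrow> 1" unfolding m_def t_def by real_asymp
  \<comment> \<open>Substituting \<open>w \<mapsto> m n *\<^sub>R w\<close> in the first term moves the dilation to the weight.\<close>
  define G where "G n w = (m n ^ d * bump r (m n *\<^sub>R w) - bump r w) / t n" for n and w :: 'a
  have eq: "(LINT w|lborel. radial_diff (t n) f w * bump r w) = (LINT w|lborel. f w * G n w)" for n
  proof -
    have c1: "continuous_on UNIV (\<lambda>w. f ((1 + t n) *\<^sub>R w) * bump r w)"
      and c2: "continuous_on UNIV (\<lambda>w. f w * bump r w)"
      and c3: "continuous_on UNIV (\<lambda>w. m n ^ d * (f w * bump r (m n *\<^sub>R w)))"
      by (intro continuous_intros continuous_shift[OF f] f)+
    have i1: "integrable lborel (\<lambda>w. f ((1 + t n) *\<^sub>R w) * bump r w)"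
      using r by (intro integrable_continuous_support[OF c1, of r]) (simp add: bump_eq_0)
    have i2: "integrable lborel (\<lambda>w. f w * bump r w)"
      using r by (intro integrable_continuous_support[OF c2, of r]) (simp add: bump_eq_0)
    have i3: "integrable lborel (\<lambda>w. m n ^ d * (f w * bump r (m n *\<^sub>R w)))"
    proof (intro integrable_continuous_support[OF c3, of "2 * r"])
      fix w :: 'a assume "norm w > 2 * r"
      then have "m n * norm w \<ge> 1/2 * (2 * r)" using m[of n] r by (intro mult_mono) auto
      then have "norm (m n *\<^sub>R w) \<ge> r" using m[of n] by simp
      then show "m n ^ d * (f w * bump r (m n *\<^sub>R w)) = 0" using r by (simp add: bump_eq_0)
    qed
    have "(LINT w|lborel. f ((1 + t n) *\<^sub>R w) * bump r w)
      = m n ^ d * (LINT w|lborel. f ((1 + t n) *\<^sub>R (m n *\<^sub>R w)) * bump r (m n *\<^sub>R w))"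
      using m(1)[of n] unfolding d_def
      by (subst lborel_integral_scale[of _ "m n"]) (auto intro!: borel_measurable_continuous_onI c1)
    also have "\<dots> = (LINT w|lborel. m n ^ d * (f w * bump r (m n *\<^sub>R w)))"
      using m(4)[of n] by (simp add: mult.commute)
    finally have 1: "(LINT w|lborel. f ((1 + t n) *\<^sub>R w) * bump r w) = \<dots>" .
    have "(LINT w|lborel. radial_diff (t n) f w * bump r w)
      = (LINT w|lborel. (f ((1 + t n) *\<^sub>R w) * bump r w - f w * bump r w) / t n)"
      by (simp add: radial_diff_def left_diff_distrib)
    also have "\<dots> = ((LINT w|lborel. m n ^ d * (f w * bump r (m n *\<^sub>R w))) - (LINT w|lborel. f w * bump r w)) / t n"
      using i1 i2 by (simp add: Bochner_Integration.integral_diff 1)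
    also have "\<dots> = (LINT w|lborel. (m n ^ d * (f w * bump r (m n *\<^sub>R w)) - f w * bump r w) / t n)"
      using Bochner_Integration.integral_diff[OF i3 i2] by simp
    also have "\<dots> = (LINT w|lborel. f w * G n w)"
      by (simp add: G_def algebra_simps)
    finally show ?thesis .
  qed
  define D where "D w = (real d + 2) * (norm w)\<^sup>2 - real d * r\<^sup>2" for w :: 'a
  have meas [measurable]: "f \<in> borel_measurable borel" "D \<in> borel_measurable borel"
    unfolding D_def by (intro borel_measurable_continuous_onI continuous_intros f)+
  have lim: "(\<lambda>n. G n w) \<longlonglongrightarrow> indicator (ball 0 r) w * D w" if w: "norm w \<noteq> r" for w
  proof (cases "norm w < r")
    case True
    define P where "P x = r\<^sup>2 * x ^ d - (norm w)\<^sup>2 * x ^ (d + 2)" for x :: real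
    have "(P has_real_derivative - D w) (at 1)"
      unfolding P_def D_def by (auto intro!: derivative_eq_intros simp: algebra_simps)
    then have "((\<lambda>x. (P x - P 1) / (x - 1)) \<longlongrightarrow> - D w) (at 1)"
      by (simp add: has_field_derivative_iff)
    moreover have "filterlim m (at 1) sequentially"
      using m1 m(2) by (auto simp: filterlim_at less_imp_neq)
    ultimately have "(\<lambda>n. (P (m n) - P 1) / (m n - 1)) \<longlonglongrightarrow> - D w"
      by (rule filterlim_compose)
    then have "(\<lambda>n. (P (m n) - P 1) / (m n - 1) * (- m n)) \<longlonglongrightarrow> - D w * (- 1)"
      by (intro tendsto_intros m1)
    moreover have "(P (m n) - P 1) / (m n - 1) * (- m n) = G n w" for n
    proof -
      have "norm (m n *\<^sub>R w) \<le> r" using m(1,2)[of n] True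
        by (simp add: mult_left_le_one_le order_trans[of _ "norm w"])
      then have "G n w = (P (m n) - P 1) / t n"
        using True m(1)[of n]
        by (simp add: G_def P_def bump_inside power_mult_distrib algebra_simps power_add power2_eq_square)
      also have "\<dots> = (P (m n) - P 1) / (m n - 1) * ((m n - 1) / t n)"
        using m(2)[of n] by simp
      finally show ?thesis using m6[of n] by simp
    qed
    ultimately show ?thesis using True by simp
  next
    case False
    then have nw: "norm w > r" using w by simp
    have "(\<lambda>n. m n * norm w) \<longlonglongrightarrow> 1 * norm w" by (intro tendsto_intros m1)
    then have "eventually (\<lambda>n. m n * norm w > r) sequentially"
      using nw by (intro order_tendstoD) auto
    then have "eventually (\<lambda>n. G n w = 0) sequentially"
    proof eventually_elim
      case (elim n)
      then have "norm (m n *\<^sub>R w) \<ge> r" using m(1)[of n] by simp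
      then show ?case using nw r by (simp add: G_def bump_eq_0)
    qed
    then show ?thesis using False by (simp add: tendsto_eventually)
  qed
  define C where "C = real d * r\<^sup>2 + 8 * r\<^sup>2"
  have bound: "\<bar>G n w\<bar> \<le> C * indicator (cball 0 (2 * r)) w" for n w
  proof (cases "norm w \<le> 2 * r")
    case True
    have "1 + real d * (m n - 1) \<le> (1 + (m n - 1)) ^ d"
      using m(1)[of n] by (intro Bernoulli_inequality) auto
    then have "1 - m n ^ d \<le> real d * (1 - m n)" by (simp add: algebra_simps)
    also have "\<dots> \<le> real d * t n" using m(3) by (intro mult_left_mono) auto
    finally have md: "1 - m n ^ d \<le> real d * t n" .
    have md1: "m n ^ d \<le> 1" "0 \<le> m n ^ d" using m(1,2)[of n] by (auto intro!: power_le_one)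
    have "\<bar>bump r (m n *\<^sub>R w) - bump r w\<bar> \<le> (norm w)\<^sup>2 * (1 - (m n)\<^sup>2)"
    proof -
      have "(m n)\<^sup>2 \<le> 1" using m(1,2)[of n] by (auto intro!: power_le_one)
      then have "(m n)\<^sup>2 * (norm w)\<^sup>2 \<le> 1 * (norm w)\<^sup>2" by (intro mult_right_mono) auto
      then show ?thesis by (auto simp: bump_def power_mult_distrib algebra_simps max_def)
    qed
    also have "\<dots> \<le> (2 * r)\<^sup>2 * (2 * t n)"
    proof (intro mult_mono power_mono)
      have "1 - (m n)\<^sup>2 = (1 - m n) * (1 + m n)" by (simp add: power2_eq_square algebra_simps)
      also have "\<dots> \<le> t n * 2" using m(1,2,3)[of n] t(1)[of n] by (intro mult_mono) auto
      finally show "1 - (m n)\<^sup>2 \<le> 2 * t n" by simp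
      show "0 \<le> 1 - (m n)\<^sup>2" using m(1,2)[of n] by (auto intro!: power_le_one)
    qed (use True in auto)
    finally have 1: "\<bar>bump r (m n *\<^sub>R w) - bump r w\<bar> \<le> 8 * r\<^sup>2 * t n" by (simp add: power_mult_distrib)
    have "m n ^ d * bump r (m n *\<^sub>R w) - bump r w
      = (bump r (m n *\<^sub>R w) - bump r w) - (1 - m n ^ d) * bump r (m n *\<^sub>R w)"
      by (simp add: algebra_simps)
    also have "\<bar>\<dots>\<bar> \<le> \<bar>bump r (m n *\<^sub>R w) - bump r w\<bar> + \<bar>(1 - m n ^ d) * bump r (m n *\<^sub>R w)\<bar>"
      by (rule abs_triangle_ineq4)
    also have "\<bar>(1 - m n ^ d) * bump r (m n *\<^sub>R w)\<bar> \<le> (real d * t n) * r\<^sup>2"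
      unfolding abs_mult using md md1 bump_nonneg[of r "m n *\<^sub>R w"] bump_le[of r "m n *\<^sub>R w"] t(1)[of n]
      by (intro mult_mono) auto
    finally have "\<bar>m n ^ d * bump r (m n *\<^sub>R w) - bump r w\<bar> \<le> C * t n"
      using 1 by (simp add: C_def algebra_simps)
    then have "\<bar>G n w\<bar> \<le> C" using t(1)[of n] by (simp add: G_def pos_divide_le_eq)
    then show ?thesis using True by simp
  next
    case False
    have "m n * norm w \<ge> 1/2 * (2 * r)" using m[of n] r False by (intro mult_mono) auto
    then have "norm (m n *\<^sub>R w) \<ge> r" using m[of n] by simp
    then show ?thesis using False r by (simp add: G_def bump_eq_0)
  qed
  have "(\<lambda>n. LINT w|lborel. f w * G n w) \<longlonglongrightarrow> (LINT w|lborel. f w * (indicator (ball 0 r) w * D w))"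
  proof (rule integral_dominated_convergence[where
        w = "\<lambda>w. indicator (cball 0 (2 * r)) w *\<^sub>R (\<bar>f w\<bar> * C)"])
    show "(\<lambda>w. f w * (indicator (ball 0 r) w * D w)) \<in> borel_measurable lborel"
      by (intro borel_measurable_times borel_measurable_indicator) (use meas in simp_all)
    show "(\<lambda>w. f w * G n w) \<in> borel_measurable lborel" for n
      unfolding G_def divide_inverse by (auto intro!: borel_measurable_continuous_onI continuous_intros f)
    show "integrable lborel (\<lambda>w. indicator (cball 0 (2 * r)) w *\<^sub>R (\<bar>f w\<bar> * C))"
      using f by (intro borel_integrable_compact) (auto intro!: continuous_intros continuous_on_subset[OF f])
    show "AE w in lborel. (\<lambda>n. f w * G n w) \<longlonglongrightarrow> f w * (indicator (ball 0 r) w * D w)"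
      using lborel_AE_not_sphere[of 0 r] by eventually_elim (auto intro!: tendsto_mult lim)
    show "AE w in lborel. norm (f w * G n w) \<le> indicator (cball 0 (2 * r)) w *\<^sub>R (\<bar>f w\<bar> * C)" for n
    proof (rule AE_I2)
      fix w
      have "\<bar>f w\<bar> * \<bar>G n w\<bar> \<le> \<bar>f w\<bar> * (C * indicator (cball 0 (2 * r)) w)"
        by (intro mult_left_mono bound) auto
      then show "norm (f w * G n w) \<le> indicator (cball 0 (2 * r)) w *\<^sub>R (\<bar>f w\<bar> * C)"
        by (simp add: abs_mult mult_ac)
    qed
  qed
  moreover have "(LINT w|lborel. f w * (indicator (ball 0 r) w * D w)) = flux f r"
    unfolding flux_def set_lebesgue_integral_def D_def d_def
    by (rule Bochner_Integration.integral_cong) (auto simp: mult_ac)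
  ultimately show ?thesis unfolding eq[symmetric] by (simp add: t_def)
qed

section \<open>Moments of the ball\<close>

abbreviation ball_integral :: "('a::euclidean_space \<Rightarrow> real) \<Rightarrow> real \<Rightarrow> real" where
  "ball_integral f r \<equiv> (LINT w:ball 0 r|lborel. f w)"

lemma ball_integral_const_1:
  "r \<ge> 0 \<Longrightarrow> ball_integral (\<lambda>w::'a::euclidean_space. 1) r = unit_ball_vol (real DIM('a)) * r ^ DIM('a)"
  by (simp add: set_lebesgue_integral_def content_ball)

lemma integral_bump:
  fixes f :: "'a::euclidean_space \<Rightarrow> real"
  assumes f: "continuous_on UNIV f" and "r \<ge> 0"
  shows "(LINT w|lborel. f w * bump r w) = r\<^sup>2 * ball_integral f r - ball_integral (\<lambda>w. f w * (norm w)\<^sup>2) r"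
proof -
  have "f w * bump r w = indicator (ball 0 r) w *\<^sub>R (r\<^sup>2 * f w - f w * (norm w)\<^sup>2)" for w
    using assms(2) by (cases "norm w < r") (auto simp: bump_inside bump_eq_0 algebra_simps)
  then have "(LINT w|lborel. f w * bump r w) = (LINT w:ball 0 r|lborel. r\<^sup>2 * f w - f w * (norm w)\<^sup>2)"
    by (simp add: set_lebesgue_integral_def)
  also have "\<dots> = (LINT w:ball 0 r|lborel. r\<^sup>2 * f w) - ball_integral (\<lambda>w. f w * (norm w)\<^sup>2) r"
    by (intro set_integral_diff set_integrable_ball continuous_intros f)
  finally show ?thesis by simp
qed

lemma flux_eq:
  fixes f :: "'a::euclidean_space \<Rightarrow> real"
  assumes f: "continuous_on UNIV f"
  shows "flux f r = (real DIM('a) + 2) * ball_integral (\<lambda>w. f w * (norm w)\<^sup>2) r - real DIM('a) * r\<^sup>2 * ball_integral f r"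
proof -
  have "flux f r = (LINT w:ball 0 r|lborel. (real DIM('a) + 2) * (f w * (norm w)\<^sup>2) - (real DIM('a) * r\<^sup>2) * f w)"
    unfolding flux_def by (rule arg_cong[of _ _ "\<lambda>g. set_lebesgue_integral lborel (ball 0 r) g"]) (auto simp: algebra_simps)
  also have "\<dots> = (LINT w:ball 0 r|lborel. (real DIM('a) + 2) * (f w * (norm w)\<^sup>2)) - (LINT w:ball 0 r|lborel. (real DIM('a) * r\<^sup>2) * f w)"
    by (intro set_integral_diff set_integrable_ball continuous_intros f)
  finally show ?thesis by simp
qed

text \<open>
  Euler's relation: the radial derivative of a function that is homogeneous of degree \<open>k\<close> is
  \<open>k\<close> times the function.
\<close>

lemma flux_homogeneous:
  fixes f :: "'a::euclidean_space \<Rightarrow> real"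
  assumes f: "continuous_on UNIV f" and r: "r > 0"
    and hom: "\<And>a w. a > 0 \<Longrightarrow> f (a *\<^sub>R w) = a ^ k * f w"
  shows "flux f r = real k * (LINT w|lborel. f w * bump r w)"
proof -
  define t where "t n = 1 / real (Suc n)" for n
  have t: "0 < t n" for n by (simp add: t_def)
  have "((\<lambda>x::real. x ^ k) has_real_derivative real k) (at 1)"
    by (auto intro!: derivative_eq_intros)
  then have "((\<lambda>h. ((1 + h) ^ k - 1) / h) \<longlongrightarrow> real k) (at (0::real))"
    by (simp add: DERIV_def)
  moreover have "filterlim t (at 0) sequentially"
  proof -
    have "t \<longlonglongrightarrow> 0" unfolding t_def by real_asymp
    then show ?thesis using t by (auto simp: filterlim_at less_imp_neq[symmetric])
  qed
  ultimately have "(\<lambda>n. ((1 + t n) ^ k - 1) / t n) \<longlonglongrightarrow> real k"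
    by (rule filterlim_compose)
  then have "(\<lambda>n. ((1 + t n) ^ k - 1) / t n * (LINT w|lborel. f w * bump r w))
    \<longlonglongrightarrow> real k * (LINT w|lborel. f w * bump r w)"
    by (intro tendsto_intros)
  moreover have "((1 + t n) ^ k - 1) / t n * (LINT w|lborel. f w * bump r w)
    = (LINT w|lborel. radial_diff (t n) f w * bump r w)" for n
  proof -
    have "radial_diff (t n) f w = ((1 + t n) ^ k - 1) / t n * f w" for w
      using t[of n] by (simp add: radial_diff_def hom left_diff_distrib)
    then show ?thesis by (simp add: mult.assoc)
  qed
  ultimately show ?thesis
    using radial_diff_tendsto[OF f r] LIMSEQ_unique unfolding t_def by auto
qed

text \<open>
  Euler's relation is a linear equation between the integrals of \<open>f w\<close> and of
  \<open>f w * (norm w)\<^sup>2\<close>, which takes the place of an integration in polar coordinates.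
\<close>

lemma integral_homogeneous:
  fixes f :: "'a::euclidean_space \<Rightarrow> real"
  assumes f: "continuous_on UNIV f" and r: "r > 0"
    and hom: "\<And>a w. a > 0 \<Longrightarrow> f (a *\<^sub>R w) = a ^ k * f w"
  shows "ball_integral (\<lambda>w. f w * (norm w)\<^sup>2) r
      = (real DIM('a) + real k) / (real DIM('a) + real k + 2) * r\<^sup>2 * ball_integral f r"
    and "(LINT w|lborel. f w * bump r w) = 2 * r\<^sup>2 / (real DIM('a) + real k + 2) * ball_integral f r"
proof -
  define A where "A = ball_integral f r"
  define B where "B = ball_integral (\<lambda>w. f w * (norm w)\<^sup>2) r"
  define d where "d = real DIM('a)"
  have d: "d + real k + 2 > 0" by (simp add: d_def)
  have "(d + 2) * B - d * r\<^sup>2 * A = real k * (r\<^sup>2 * A - B)"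
    using flux_homogeneous[OF f r hom] r unfolding flux_eq[OF f] integral_bump[OF f less_imp_le[OF r]]
    by (simp add: A_def B_def d_def)
  then have "(d + real k + 2) * B = (d + real k) * r\<^sup>2 * A" by (simp add: algebra_simps)
  then have B: "B = (d + real k) / (d + real k + 2) * r\<^sup>2 * A" using d by (simp add: field_simps)
  then show "ball_integral (\<lambda>w. f w * (norm w)\<^sup>2) r
      = (real DIM('a) + real k) / (real DIM('a) + real k + 2) * r\<^sup>2 * ball_integral f r"
    by (simp add: A_def B_def d_def)
  have "r\<^sup>2 * A - B = 2 * r\<^sup>2 / (d + real k + 2) * A"
    unfolding B using d by (simp add: field_simps)
  then show "(LINT w|lborel. f w * bump r w) = 2 * r\<^sup>2 / (real DIM('a) + real k + 2) * ball_integral f r"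
    using r unfolding integral_bump[OF f less_imp_le[OF r]] by (simp add: A_def B_def d_def)
qed

lemma integral_bump_square:
  fixes r :: real
  assumes r: "r > 0"
  shows "(LINT w|lborel. (bump r (w::'a::euclidean_space))\<^sup>2)
    = 8 * r ^ 4 / ((real DIM('a) + 2) * (real DIM('a) + 4)) * (unit_ball_vol (real DIM('a)) * r ^ DIM('a))"
proof -
  define d where "d = real DIM('a)"
  define V where "V = unit_ball_vol d * r ^ DIM('a)"
  have V: "ball_integral (\<lambda>w::'a. 1) r = V" using r unfolding V_def d_def by (intro ball_integral_const_1) auto
  have d: "d > 0" by (simp add: d_def)
  have c1: "continuous_on UNIV (\<lambda>w::'a. 1::real)" and c2: "continuous_on UNIV (\<lambda>w::'a. (norm w)\<^sup>2)"
    by (intro continuous_intros)+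
  have m0: "(LINT w|lborel. bump r (w::'a)) = 2 * r\<^sup>2 / (d + 2) * V"
    using integral_homogeneous(2)[OF c1 r, of 0] by (simp add: V d_def)
  have m2: "ball_integral (\<lambda>w::'a. (norm w)\<^sup>2) r = d / (d + 2) * r\<^sup>2 * V"
    using integral_homogeneous(1)[OF c1 r, of 0] by (simp add: V d_def)
  have m2': "(LINT w|lborel. (norm (w::'a))\<^sup>2 * bump r w) = 2 * r\<^sup>2 / (d + 4) * (d / (d + 2) * r\<^sup>2 * V)"
    using integral_homogeneous(2)[OF c2 r, of 2] m2 by (simp add: d_def power_mult_distrib)
  have i1: "integrable lborel (\<lambda>w::'a. r\<^sup>2 * bump r w)" and i2: "integrable lborel (\<lambda>w::'a. (norm w)\<^sup>2 * bump r w)"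
    using r by (auto intro!: integrable_continuous_support[where r=r] continuous_intros simp: bump_eq_0)
  have "(bump r w)\<^sup>2 = r\<^sup>2 * bump r w - (norm w)\<^sup>2 * bump r w" for w :: 'a
    by (auto simp: bump_def max_def power2_eq_square algebra_simps)
  then have "(LINT w|lborel. (bump r (w::'a))\<^sup>2) = r\<^sup>2 * (2 * r\<^sup>2 / (d + 2) * V) - 2 * r\<^sup>2 / (d + 4) * (d / (d + 2) * r\<^sup>2 * V)"
    using Bochner_Integration.integral_diff[OF i1 i2] by (simp add: m0 m2')
  also have "\<dots> = 8 * r ^ 4 / ((d + 2) * (d + 4)) * V"
    using d by (simp add: divide_simps power2_eq_square power4_eq_xxxx) (simp add: algebra_simps)
  finally show ?thesis by (simp add: d_def V_def)
qed

text \<open>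
  The function \<open>w \<mapsto> (u \<bullet> w)\<^sup>2\<close> has constant Laplacian \<open>2 * (norm u)\<^sup>2\<close>, so
  its flux is known from the integral of the squared weight; by homogeneity the flux also
  determines its integral.
\<close>

lemma ball_integral_inner_square:
  fixes u :: "'a::euclidean_space"
  assumes r: "r > 0"
  shows "ball_integral (\<lambda>w. (u \<bullet> w)\<^sup>2) r
    = (norm u)\<^sup>2 * r\<^sup>2 / (real DIM('a) + 2) * (unit_ball_vol (real DIM('a)) * r ^ DIM('a))"
proof -
  define d where "d = real DIM('a)"
  have d: "d > 0" by (simp add: d_def)
  define V where "V = unit_ball_vol d * r ^ DIM('a)"
  define f where "f = (\<lambda>w. (u \<bullet> w)\<^sup>2)"
  have f: "continuous_on UNIV f" unfolding f_def by (intro continuous_intros)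
  have "laplace_diff t f w = 2 * (norm u)\<^sup>2" if "t \<noteq> 0" for t w
  proof -
    have "(f (w + t *\<^sub>R b) + f (w - t *\<^sub>R b) - 2 * f w) / t\<^sup>2 = 2 * (u \<bullet> b)\<^sup>2" for b
    proof -
      have "f (w + t *\<^sub>R b) + f (w - t *\<^sub>R b) - 2 * f w = 2 * (u \<bullet> b)\<^sup>2 * t\<^sup>2"
        by (simp add: f_def inner_add inner_diff power2_eq_square algebra_simps)
      then show ?thesis using that by simp
    qed
    then have "laplace_diff t f w = 2 * (\<Sum>b\<in>Basis. (u \<bullet> b)\<^sup>2)"
      by (simp add: laplace_diff_def sum_distrib_left)
    also have "(\<Sum>b\<in>Basis. (u \<bullet> b)\<^sup>2) = (norm u)\<^sup>2"
      unfolding power2_norm_eq_inner by (subst euclidean_inner) (simp add: power2_eq_square)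
    finally show ?thesis .
  qed
  then have "(\<lambda>n. (LINT w|lborel. (bump r (w::'a))\<^sup>2) * (2 * (norm u)\<^sup>2)) \<longlonglongrightarrow> 4 * flux f r"
    using laplace_diff_bump_square_tendsto[OF f r] by simp
  then have "(LINT w|lborel. (bump r (w::'a))\<^sup>2) * (2 * (norm u)\<^sup>2) = 4 * flux f r"
    using LIMSEQ_const_iff by blast
  also have "flux f r = 2 * (LINT w|lborel. f w * bump r w)"
    using flux_homogeneous[OF f r, of 2] by (simp add: f_def power_mult_distrib)
  also have "(LINT w|lborel. f w * bump r w) = 2 * r\<^sup>2 / (d + 4) * ball_integral f r"
    using integral_homogeneous(2)[OF f r, of 2] by (simp add: f_def power_mult_distrib d_def)
  finally have "8 * r ^ 4 / ((d + 2) * (d + 4)) * V * (2 * (norm u)\<^sup>2) = 4 * (2 * (2 * r\<^sup>2 / (d + 4) * ball_integral f r))"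
    unfolding integral_bump_square[OF r] by (simp add: V_def d_def)
  then have "16 * r\<^sup>2 / (d + 4) * (r\<^sup>2 / (d + 2) * V * (norm u)\<^sup>2) = 16 * r\<^sup>2 / (d + 4) * ball_integral f r"
    using d by (simp add: divide_simps power2_eq_square power4_eq_xxxx)
  then have "r\<^sup>2 / (d + 2) * V * (norm u)\<^sup>2 = ball_integral f r"
    using r d by (subst (asm) mult_left_cancel) auto
  then show ?thesis by (simp add: f_def V_def d_def mult_ac)
qed

section \<open>Upper and lower bounds for the flux\<close>

text \<open>
  The radial difference quotient at \<open>w\<close> is at most \<open>L * norm w\<close>, which is \<open>L\<close> times that
  of the norm.
\<close>

lemma flux_le_lipschitz:
  fixes f :: "'a::euclidean_space \<Rightarrow> real"
  assumes f: "L-lipschitz_on UNIV f" and r: "r > 0"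
  shows "flux f r \<le> 2 * L * unit_ball_vol (real DIM('a)) * r ^ (DIM('a) + 3) / (real DIM('a) + 3)"
proof -
  have L: "L \<ge> 0" using f by (rule lipschitz_on_nonneg)
  have cf: "continuous_on UNIV f" using f by (rule lipschitz_on_continuous_on)
  have cn: "continuous_on UNIV (norm :: 'a \<Rightarrow> real)" by (intro continuous_intros)
  define V where "V = unit_ball_vol (real DIM('a)) * r ^ DIM('a)"
  have "(LINT w|lborel. radial_diff (1 / real (Suc n)) f w * bump r w) \<le> (LINT w|lborel. L * (norm (w::'a) * bump r w))" for n
  proof (rule integral_mono)
    define t where "t = 1 / real (Suc n)"
    have t: "t > 0" by (simp add: t_def)
    show "integrable lborel (\<lambda>w. radial_diff (1 / real (Suc n)) f w * bump r w)"
      unfolding radial_diff_def divide_inverse using r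
      by (intro integrable_continuous_support[where r=r])
        (auto intro!: continuous_intros continuous_shift cf simp: bump_eq_0)
    show "integrable lborel (\<lambda>w::'a. L * (norm w * bump r w))"
      using r by (intro integrable_continuous_support[where r=r]) (auto intro!: continuous_intros simp: bump_eq_0)
    fix w :: 'a
    have "f ((1 + t) *\<^sub>R w) - f w \<le> L * norm ((1 + t) *\<^sub>R w - w)"
      using lipschitz_onD[OF f, of "(1 + t) *\<^sub>R w" w] by (simp add: dist_norm)
    also have "(1 + t) *\<^sub>R w - w = t *\<^sub>R w" by (simp add: algebra_simps)
    finally have "radial_diff t f w \<le> L * norm w" using t by (simp add: radial_diff_def pos_divide_le_eq mult_ac)
    then have "radial_diff t f w * bump r w \<le> L * norm w * bump r w"
      by (rule mult_right_mono) (rule bump_nonneg)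
    then show "radial_diff (1 / real (Suc n)) f w * bump r w \<le> L * (norm w * bump r w)"
      by (simp add: t_def mult.assoc)
  qed
  then have "flux f r \<le> (LINT w|lborel. L * (norm (w::'a) * bump r w))"
    by (intro LIMSEQ_le_const2[OF radial_diff_tendsto[OF cf r]]) auto
  also have "\<dots> = L * (2 * r\<^sup>2 / (real DIM('a) + 3) * ball_integral (norm :: 'a \<Rightarrow> real) r)"
    using integral_homogeneous(2)[OF cn r, of 1] by (simp add: add.commute)
  also have "\<dots> \<le> L * (2 * r\<^sup>2 / (real DIM('a) + 3) * (r * V))"
  proof -
    have "ball_integral (norm :: 'a \<Rightarrow> real) r \<le> ball_integral (\<lambda>w::'a. r * 1) r"
      by (intro set_integral_mono set_integrable_ball continuous_intros) auto
    also have "\<dots> = r * ball_integral (\<lambda>w::'a. 1) r" by (rule set_integral_mult_right)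
    also have "\<dots> = r * V"
      using r ball_integral_const_1[of r, where ?'a='a] by (simp add: V_def)
    finally show ?thesis using r L by (intro mult_left_mono) auto
  qed
  also have "\<dots> = 2 * L * unit_ball_vol (real DIM('a)) * r ^ (DIM('a) + 3) / (real DIM('a) + 3)"
    by (simp add: V_def power_add power2_eq_square power3_eq_cube)
  finally show ?thesis .
qed

text \<open>
  Along rays from the centre a convex function grows at least as fast as its chord.
\<close>

lemma flux_ge_convex:
  fixes f :: "'a::euclidean_space \<Rightarrow> real"
  assumes conv: "convex_on UNIV f" and f: "continuous_on UNIV f" and r: "r > 0"
  shows "(LINT w|lborel. (f w - f 0) * bump r w) \<le> flux f r"
proof (intro LIMSEQ_le_const[OF radial_diff_tendsto[OF f r]] exI allI impI)
  fix n
  define t where "t = 1 / real (Suc n)"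
  have t: "t > 0" by (simp add: t_def)
  show "(LINT w|lborel. (f w - f 0) * bump r w) \<le> (LINT w|lborel. radial_diff (1 / real (Suc n)) f w * bump r w)"
  proof (rule integral_mono)
    show "integrable lborel (\<lambda>w. radial_diff (1 / real (Suc n)) f w * bump r w)"
      unfolding radial_diff_def divide_inverse using r
      by (intro integrable_continuous_support[where r=r])
        (auto intro!: continuous_intros continuous_shift f simp: bump_eq_0)
    show "integrable lborel (\<lambda>w. (f w - f 0) * bump r w)"
      using r by (intro integrable_continuous_support[where r=r]) (auto intro!: continuous_intros f simp: bump_eq_0)
    fix w :: 'a
    have "f ((1 - 1 / (1 + t)) *\<^sub>R 0 + (1 / (1 + t)) *\<^sub>R ((1 + t) *\<^sub>R w))
      \<le> (1 - 1 / (1 + t)) * f 0 + 1 / (1 + t) * f ((1 + t) *\<^sub>R w)"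
      using t by (intro convex_onD[OF conv]) auto
    then have "(1 + t) * f w \<le> (1 + t) * ((1 - 1 / (1 + t)) * f 0 + 1 / (1 + t) * f ((1 + t) *\<^sub>R w))"
      using t by simp
    also have "\<dots> = (1 + t) * (1 - 1 / (1 + t)) * f 0 + (1 + t) * (1 / (1 + t)) * f ((1 + t) *\<^sub>R w)"
      by (simp only: distrib_left mult.assoc)
    also have "(1 + t) * (1 - 1 / (1 + t)) = t" using t by (simp add: field_simps)
    also have "(1 + t) * (1 / (1 + t)) = 1" using t by simp
    finally have "t * (f w - f 0) \<le> f ((1 + t) *\<^sub>R w) - f w" by (simp add: left_diff_distrib right_diff_distrib distrib_right)
    then have "f w - f 0 \<le> radial_diff t f w" using t by (simp add: radial_diff_def pos_le_divide_eq mult.commute)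
    then show "(f w - f 0) * bump r w \<le> radial_diff (1 / real (Suc n)) f w * bump r w"
      unfolding t_def by (rule mult_right_mono) (rule bump_nonneg)
  qed
qed

text \<open>
  The hypothesis, applied to \<open>w\<close> and to \<open>- w\<close>, bounds the second difference of \<open>f\<close> around the
  centre below by that of a wedge of slope jump \<open>\<beta>\<close> with edge orthogonal to \<open>u\<close>, lowered by
  \<open>\<beta> * \<eta>\<close>.  This bound is nonnegative on the cap \<open>u \<bullet> w > \<eta>\<close> of the ball of radius \<open>3 * \<eta>\<close>, and on the
  opposite cap.  The first contains the half ball of radius \<open>3 / 2 * \<eta>\<close> around
  \<open>\<eta> *\<^sub>R u\<close>.  With \<open>s = u \<bullet> v\<close> for a point \<open>v\<close> of the centred half ball, the second
  difference is at least \<open>\<beta> * s\<close> at \<open>v + \<eta> *\<^sub>R u\<close>, and the weight is at least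
  \<open>23 / 4 * \<eta>\<^sup>2 - 2 * \<eta> * s\<close>, hence at least \<open>11 / 6 * \<eta> * s\<close> because
  \<open>s \<le> 3 / 2 * \<eta>\<close>.  The two half balls together give the second moment of a full ball,
  and no factor that decays exponentially in the dimension is lost.
\<close>

lemma flux_ge_wedge:
  fixes f :: "'a::euclidean_space \<Rightarrow> real"
  assumes conv: "convex_on UNIV f" and f: "continuous_on UNIV f" and \<eta>: "\<eta> > 0" and u: "norm u = 1"
    and \<beta>: "\<beta> \<ge> 0" and wedge: "\<And>w. f w + f (- w) - 2 * f 0 \<ge> \<beta> * (u \<bullet> w - \<eta>)"
  shows "flux f (3 * \<eta>) \<ge> 11 / 12 * \<beta> * \<eta> *
    ((3 / 2 * \<eta>)\<^sup>2 / (real DIM('a) + 2) * (unit_ball_vol (real DIM('a)) * (3 / 2 * \<eta>) ^ DIM('a)))"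
proof -
  define G where "G w = f w + f (- w) - 2 * f 0" for w
  define b where "b w = bump (3 * \<eta>) w" for w :: 'a
  define \<rho> where "\<rho> = 3 / 2 * \<eta>"
  define k where "k v = 11 / 6 * \<beta> * \<eta> * (u \<bullet> v)\<^sup>2" for v
  \<comment> \<open>The two half balls, before they are shifted by \<open>\<plusminus> \<eta> *\<^sub>R u\<close>.\<close>
  define Hp where "Hp = ball 0 \<rho> \<inter> {v. u \<bullet> v > 0}"
  define Hn where "Hn = ball 0 \<rho> \<inter> {v. u \<bullet> v < 0}"
  define kp where "kp v = indicator Hp v * k v" for v
  define kn where "kn v = indicator Hn v * k v" for v
  have ck: "continuous_on A k" for A unfolding k_def by (intro continuous_intros)
  have [measurable]: "k \<in> borel_measurable borel" by (intro borel_measurable_continuous_onI ck)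
  have [measurable]: "Hp \<in> sets borel" "Hn \<in> sets borel"
    unfolding Hp_def Hn_def by (intro sets.Int borel_open open_Collect_less continuous_intros open_ball)+
  have [measurable]: "kp \<in> borel_measurable borel" "kn \<in> borel_measurable borel"
    unfolding kp_def kn_def by measurable
  have kpos: "k v \<ge> 0" for v using \<beta> \<eta> by (simp add: k_def)
  have ib: "set_integrable lborel (ball 0 \<rho>) k" by (intro set_integrable_ball ck)
  have ikp: "integrable lborel kp"
    using set_integrable_subset[OF ib, of Hp] by (simp add: set_integrable_def kp_def[abs_def] Hp_def)
  have ikn: "integrable lborel kn"
    using set_integrable_subset[OF ib, of Hn] by (simp add: set_integrable_def kn_def[abs_def] Hn_def)
  have shift_int: "integrable lborel (\<lambda>w. g (c + w))" if "integrable lborel g" for g :: "'a \<Rightarrow> real" and c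
  proof -
    have "integrable (distr lborel borel ((+) c)) g" using that by (simp add: lborel_distr_plus)
    then show ?thesis by (subst (asm) integrable_distr_eq) (use that in auto)
  qed
  have half: "k v \<le> G w * b w"
    if v: "v \<in> ball 0 \<rho>" "u \<bullet> v > 0" and w: "w = v + \<eta> *\<^sub>R u" for v w
  proof -
    define s where "s = u \<bullet> v"
    have s: "s > 0" "s \<le> \<rho>"
      using v Cauchy_Schwarz_ineq2[of u v] u by (auto simp: s_def)
    have "u \<bullet> w = s + \<eta>" using u by (simp add: w s_def inner_add_right dot_square_norm)
    then have G: "G w \<ge> \<beta> * s" using wedge[of w] by (simp add: G_def)
    have "(norm w)\<^sup>2 = (norm v)\<^sup>2 + 2 * \<eta> * s + \<eta>\<^sup>2"
      unfolding w norm_add_sq using u \<eta> by (simp add: s_def inner_commute)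
    moreover have "(norm v)\<^sup>2 \<le> \<rho>\<^sup>2" using v by (intro power_mono) auto
    ultimately have "b w \<ge> (3 * \<eta>)\<^sup>2 - (\<rho>\<^sup>2 + 2 * \<eta> * s + \<eta>\<^sup>2)" by (auto simp: b_def bump_def)
    also have "(3 * \<eta>)\<^sup>2 - (\<rho>\<^sup>2 + 2 * \<eta> * s + \<eta>\<^sup>2) = 11 / 6 * \<eta> * s + \<eta> * (23 / 6 * (\<rho> - s))"
      by (simp add: \<rho>_def power2_eq_square field_simps)
    finally have "11 / 6 * \<eta> * s + \<eta> * (23 / 6 * (\<rho> - s)) \<le> b w" .
    moreover have "0 \<le> \<eta> * (23 / 6 * (\<rho> - s))" using s(2) \<eta> by simp
    ultimately have B: "b w \<ge> 11 / 6 * \<eta> * s" by linarith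
    have "k v = (\<beta> * s) * (11 / 6 * \<eta> * s)" by (simp add: k_def s_def power2_eq_square)
    also have "\<dots> \<le> G w * b w"
      using G B s \<eta> \<beta> by (intro mult_mono) (auto intro: order_trans[OF _ G])
    finally show ?thesis .
  qed
  have Geven: "G (- w) = G w" and beven: "b (- w) = b w" for w by (simp_all add: G_def b_def)
  have Gnn: "G w \<ge> 0" for w
  proof -
    have "f ((1 - 1 / 2) *\<^sub>R w + (1 / 2) *\<^sub>R (- w)) \<le> (1 - 1 / 2) * f w + 1 / 2 * f (- w)"
      by (intro convex_onD[OF conv]) auto
    then show ?thesis by (simp add: G_def)
  qed
  have bnn: "b w \<ge> 0" for w by (simp add: b_def bump_nonneg)
  have pw: "kp (- \<eta> *\<^sub>R u + w) + kn (\<eta> *\<^sub>R u + w) \<le> G w * b w" for w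
  proof -
    have uu: "u \<bullet> u = 1" using u by (simp add: dot_square_norm)
    consider "- \<eta> *\<^sub>R u + w \<in> Hp" | "\<eta> *\<^sub>R u + w \<in> Hn" | "- \<eta> *\<^sub>R u + w \<notin> Hp" "\<eta> *\<^sub>R u + w \<notin> Hn" by blast
    then show ?thesis
    proof cases
      case 1
      then have "u \<bullet> w > \<eta>" by (simp add: Hp_def inner_add_right inner_diff_right uu)
      then have "\<eta> *\<^sub>R u + w \<notin> Hn" using \<eta> by (simp add: Hn_def inner_add_right uu)
      moreover have "k (- \<eta> *\<^sub>R u + w) \<le> G w * b w"
        using 1 by (intro half) (auto simp: Hp_def)
      ultimately show ?thesis using 1 by (simp add: kp_def kn_def)
    next
      case 2
      then have "u \<bullet> w < - \<eta>" by (simp add: Hn_def inner_add_right uu)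
      then have "- \<eta> *\<^sub>R u + w \<notin> Hp" using \<eta> by (simp add: Hp_def inner_add_right inner_diff_right uu)
      moreover have "k (- (\<eta> *\<^sub>R u + w)) \<le> G (- w) * b (- w)"
        using 2 by (intro half) (auto simp: Hn_def norm_minus_commute inner_diff_right inner_add_right simp flip: norm_minus_cancel[of "\<eta> *\<^sub>R u + w"])
      moreover have "k (- (\<eta> *\<^sub>R u + w)) = k (\<eta> *\<^sub>R u + w)" unfolding k_def inner_minus_right by simp
      ultimately show ?thesis using 2 by (simp add: kp_def kn_def Geven beven)
    next
      case 3
      then show ?thesis using Gnn bnn by (simp add: kp_def kn_def)
    qed
  qed
  have csym: "continuous_on UNIV (\<lambda>w. f (- w))" by (intro continuous_on_compose2[OF f] continuous_intros) auto
  have i1: "integrable lborel (\<lambda>w. (f w - f 0) * b w)"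
    using \<eta> unfolding b_def
    by (intro integrable_continuous_support[where r="3 * \<eta>"]) (auto intro!: continuous_intros f simp: bump_eq_0)
  have i2: "integrable lborel (\<lambda>w. (f (- w) - f 0) * b w)"
    using \<eta> unfolding b_def
    by (intro integrable_continuous_support[where r="3 * \<eta>"]) (auto intro!: continuous_intros csym simp: bump_eq_0)
  \<comment> \<open>The weight is even, so the flux may be bounded below by half the integral of \<open>G w * b w\<close>.\<close>
  have refl: "(LINT w|lborel. (f w - f 0) * b w) = (LINT w|lborel. (f (- w) - f 0) * b w)"
  proof -
    have "(LINT w|lborel. (f w - f 0) * b w) = \<bar>- 1\<bar> ^ DIM('a) * (LINT w|lborel. (f (- 1 *\<^sub>R w) - f 0) * b (- 1 *\<^sub>R w))"
      using i1 by (intro lborel_integral_scale) auto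
    then show ?thesis by (simp add: beven)
  qed
  have "(LINT v|lborel. k v * indicator (ball 0 \<rho>) v) = (LINT v|lborel. kp v + kn v)"
  proof (rule Bochner_Integration.integral_cong)
    fix v
    show "k v * indicator (ball 0 \<rho>) v = kp v + kn v"
      by (cases "u \<bullet> v" "0::real" rule: linorder_cases)
        (auto simp: kp_def kn_def Hp_def Hn_def k_def indicator_def)
  qed simp
  also have "\<dots> = (LINT v|lborel. kp v) + (LINT v|lborel. kn v)"
    using ikp ikn by (rule Bochner_Integration.integral_add)
  also have "\<dots> = (LINT w|lborel. kp (- \<eta> *\<^sub>R u + w)) + (LINT w|lborel. kn (\<eta> *\<^sub>R u + w))"
    by (simp only: lborel_integral_translate \<open>kp \<in> borel_measurable borel\<close> \<open>kn \<in> borel_measurable borel\<close>)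
  also have "\<dots> = (LINT w|lborel. kp (- \<eta> *\<^sub>R u + w) + kn (\<eta> *\<^sub>R u + w))"
    by (intro Bochner_Integration.integral_add[symmetric] shift_int ikp ikn)
  also have "\<dots> \<le> (LINT w|lborel. (f w - f 0) * b w + (f (- w) - f 0) * b w)"
  proof (intro integral_mono Bochner_Integration.integrable_add shift_int ikp ikn i1 i2)
    fix w
    show "kp (- \<eta> *\<^sub>R u + w) + kn (\<eta> *\<^sub>R u + w) \<le> (f w - f 0) * b w + (f (- w) - f 0) * b w"
      using pw[of w] by (simp add: G_def algebra_simps)
  qed
  also have "\<dots> = 2 * (LINT w|lborel. (f w - f 0) * b w)"
    using i1 i2 by (simp add: refl)
  also have "\<dots> \<le> 2 * flux f (3 * \<eta>)"
    using flux_ge_convex[OF conv f, of "3 * \<eta>"] \<eta> by (simp add: b_def)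
  finally have "(LINT v|lborel. k v * indicator (ball 0 \<rho>) v) \<le> 2 * flux f (3 * \<eta>)" .
  moreover have "(LINT v|lborel. k v * indicator (ball 0 \<rho>) v) = 11 / 6 * \<beta> * \<eta> * ball_integral (\<lambda>v. (u \<bullet> v)\<^sup>2) \<rho>"
    by (simp add: k_def set_lebesgue_integral_def mult.assoc mult.commute[of "indicator _ _"])
  moreover have "ball_integral (\<lambda>v. (u \<bullet> v)\<^sup>2) \<rho>
    = \<rho>\<^sup>2 / (real DIM('a) + 2) * (unit_ball_vol (real DIM('a)) * \<rho> ^ DIM('a))"
    using ball_integral_inner_square[of \<rho> u] \<eta> u by (simp add: \<rho>_def)
  ultimately have "11 / 6 * \<beta> * \<eta> * (\<rho>\<^sup>2 / (real DIM('a) + 2) * (unit_ball_vol (real DIM('a)) * \<rho> ^ DIM('a)))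
    \<le> 2 * flux f (3 * \<eta>)" by simp
  then show ?thesis unfolding \<rho>_def by linarith
qed

text \<open>
  The centre is the midpoint of \<open>y\<close> and \<open>z\<close>, so that the values of \<open>\<phi>\<close> at these two
  points cancel: the supporting planes at \<open>y\<close> and \<open>z\<close> bound the two outer terms of the second
  difference, and convexity bounds the middle term by the mean of the two values.
\<close>

lemma flux_ge_subgradients:
  fixes \<phi> :: "'a::euclidean_space \<Rightarrow> real"
  assumes conv: "convex_on UNIV \<phi>" and cont: "continuous_on UNIV \<phi>" and \<eta>: "\<eta> > 0"
    and p: "p \<in> subdifferential \<phi> y" and q: "q \<in> subdifferential \<phi> z"
    and yz: "dist y z \<le> 2 * \<eta>" and "p \<noteq> q"
  shows "flux (\<lambda>w. \<phi> (midpoint y z + w)) (3 * \<eta>) \<ge> 11 / 12 * dist p q * \<eta> *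
    ((3 / 2 * \<eta>)\<^sup>2 / (real DIM('a) + 2) * (unit_ball_vol (real DIM('a)) * (3 / 2 * \<eta>) ^ DIM('a)))"
proof -
  define c where "c = midpoint y z"
  define u where "u = (1 / dist p q) *\<^sub>R (q - p)"
  have pq: "dist p q > 0" using assms by simp
  have u: "norm u = 1" using pq by (simp add: u_def dist_norm norm_minus_commute)
  have c1: "continuous_on UNIV (\<lambda>w. \<phi> (c + w))" using cont by (rule continuous_shift)
  have c2: "convex_on UNIV (\<lambda>w. \<phi> (c + w))"
  proof (rule convex_onI)
    fix t :: real and v w assume t: "0 < t" "t < 1"
    have "\<phi> ((1 - t) *\<^sub>R (c + v) + t *\<^sub>R (c + w)) \<le> (1 - t) * \<phi> (c + v) + t * \<phi> (c + w)"
      using t by (intro convex_onD[OF conv]) auto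
    moreover have "(1 - t) *\<^sub>R (c + v) + t *\<^sub>R (c + w) = c + ((1 - t) *\<^sub>R v + t *\<^sub>R w)"
      by (simp add: algebra_simps)
    ultimately show "\<phi> (c + ((1 - t) *\<^sub>R v + t *\<^sub>R w)) \<le> (1 - t) * \<phi> (c + v) + t * \<phi> (c + w)" by simp
  qed auto
  have wedge: "\<phi> (c + w) + \<phi> (c + - w) - 2 * \<phi> (c + 0) \<ge> dist p q * (u \<bullet> w - \<eta>)" for w
  proof -
    have "\<phi> (c + w) \<ge> \<phi> z + q \<bullet> (c + w - z)" "\<phi> (c - w) \<ge> \<phi> y + p \<bullet> (c - w - y)"
      using p q by (auto simp: subdifferential_def)
    moreover have "2 * \<phi> c \<le> \<phi> y + \<phi> z"
    proof -
      have "\<phi> ((1 - 1 / 2) *\<^sub>R y + (1 / 2) *\<^sub>R z) \<le> (1 - 1 / 2) * \<phi> y + 1 / 2 * \<phi> z"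
        by (intro convex_onD[OF conv]) auto
      also have "(1 - 1 / 2) *\<^sub>R y + (1 / 2) *\<^sub>R z = c" by (simp add: c_def midpoint_def scaleR_add_right)
      finally show ?thesis by simp
    qed
    moreover have "q \<bullet> (c + w - z) + p \<bullet> (c - w - y) = (q - p) \<bullet> w - (q - p) \<bullet> ((1 / 2) *\<^sub>R (z - y))"
    proof -
      have "c - z = - (1 / 2) *\<^sub>R (z - y)" "c - y = (1 / 2) *\<^sub>R (z - y)"
        using scaleR_half_double[of z] scaleR_half_double[of y]
        by (auto simp: c_def midpoint_def algebra_simps simp flip: scaleR_left_distrib)
      then have "c + w - z = w - (1 / 2) *\<^sub>R (z - y)" "c - w - y = (1 / 2) *\<^sub>R (z - y) - w"
        by (simp_all add: algebra_simps)
      then show ?thesis by (simp only: inner_diff_left inner_diff_right)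
    qed
    moreover have "(q - p) \<bullet> ((1 / 2) *\<^sub>R (z - y)) \<le> dist p q * \<eta>"
    proof -
      have "(q - p) \<bullet> ((1 / 2) *\<^sub>R (z - y)) \<le> norm (q - p) * norm ((1 / 2) *\<^sub>R (z - y))"
        by (rule norm_cauchy_schwarz)
      also have "\<dots> \<le> norm (q - p) * \<eta>"
        using yz by (intro mult_left_mono) (auto simp: dist_norm norm_minus_commute)
      finally show ?thesis by (simp add: dist_norm norm_minus_commute)
    qed
    moreover have "dist p q * (u \<bullet> w - \<eta>) = (q - p) \<bullet> w - dist p q * \<eta>"
      using pq by (simp add: u_def right_diff_distrib)
    ultimately show ?thesis by simp
  qed
  show ?thesis
    using flux_ge_wedge[OF c2 c1 \<eta> u _ wedge] by (simp add: c_def)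
qed

section \<open>The packing estimate\<close>

lemma laplace_diff_nonneg:
  fixes \<phi> :: "'a::euclidean_space \<Rightarrow> real"
  assumes conv: "convex_on UNIV \<phi>"
  shows "laplace_diff t \<phi> w \<ge> 0"
proof -
  have "\<phi> (w + t *\<^sub>R b) + \<phi> (w - t *\<^sub>R b) - 2 * \<phi> w \<ge> 0" for b
  proof -
    have "\<phi> ((1 - 1 / 2) *\<^sub>R (w + t *\<^sub>R b) + (1 / 2) *\<^sub>R (w - t *\<^sub>R b))
      \<le> (1 - 1 / 2) * \<phi> (w + t *\<^sub>R b) + 1 / 2 * \<phi> (w - t *\<^sub>R b)"
      by (intro convex_onD[OF conv]) auto
    also have "(1 - 1 / 2) *\<^sub>R (w + t *\<^sub>R b) + (1 / 2) *\<^sub>R (w - t *\<^sub>R b) = w"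
      by (simp add: scaleR_add_right scaleR_diff_right flip: scaleR_left_distrib)
    finally show ?thesis by simp
  qed
  then show ?thesis by (simp add: laplace_diff_def sum_nonneg)
qed

text \<open>
  Each flux is a quarter of the pairing of the Laplacian of \<open>\<phi>\<close>, a nonnegative quantity, with
  a squared weight.  The small weights have disjoint supports and are at most \<open>r ^ 4\<close>, while
  the large one is at least \<open>(s\<^sup>2 - \<rho>\<^sup>2)\<^sup>2\<close> on the ball that contains these supports.
\<close>

lemma sum_flux_le:
  fixes \<phi> :: "'a::euclidean_space \<Rightarrow> real"
  assumes conv: "convex_on UNIV \<phi>" and cont: "continuous_on UNIV \<phi>"
    and "finite P" and r: "r > 0" and \<rho>: "0 < \<rho>" "\<rho> < s"
    and sub: "\<And>x. x \<in> P \<Longrightarrow> ball (c x) r \<subseteq> ball 0 \<rho>"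
    and disj: "\<And>x y. x \<in> P \<Longrightarrow> y \<in> P \<Longrightarrow> x \<noteq> y \<Longrightarrow> ball (c x) r \<inter> ball (c y) r = {}"
  shows "(\<Sum>x\<in>P. flux (\<lambda>w. \<phi> (c x + w)) r) \<le> r ^ 4 / (s\<^sup>2 - \<rho>\<^sup>2)\<^sup>2 * flux \<phi> s"
proof -
  define K where "K = r ^ 4 / (s\<^sup>2 - \<rho>\<^sup>2)\<^sup>2"
  have s2: "s\<^sup>2 - \<rho>\<^sup>2 > 0" using \<rho> by (simp add: power_strict_mono)
  have pw: "(\<Sum>x\<in>P. (bump r (w - c x))\<^sup>2) \<le> K * (bump s w)\<^sup>2" for w
  proof (cases "\<exists>x\<in>P. w \<in> ball (c x) r")
    case True
    then obtain x where x: "x \<in> P" "w \<in> ball (c x) r" by blast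
    have "bump r (w - c y) = 0" if "y \<in> P" "y \<noteq> x" for y
    proof -
      have "w \<notin> ball (c y) r" using disj[OF x(1) that(1)] that x by blast
      then show ?thesis using r by (intro bump_eq_0) (auto simp: dist_norm norm_minus_commute)
    qed
    then have "(\<Sum>y\<in>P. (bump r (w - c y))\<^sup>2) = (\<Sum>y\<in>{x}. (bump r (w - c y))\<^sup>2)"
      using x \<open>finite P\<close> by (intro sum.mono_neutral_right) auto
    also have "\<dots> \<le> (r\<^sup>2)\<^sup>2"
      using power_mono[OF bump_le bump_nonneg, of r "w - c x" 2] by simp
    also have "\<dots> = K * (s\<^sup>2 - \<rho>\<^sup>2)\<^sup>2" using s2 by (simp add: K_def)
    also have "\<dots> \<le> K * (bump s w)\<^sup>2"
    proof -
      have "norm w \<le> \<rho>" using sub[OF x(1)] x(2) by auto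
      then have "(norm w)\<^sup>2 \<le> \<rho>\<^sup>2" by (simp add: power_mono)
      then have "s\<^sup>2 - \<rho>\<^sup>2 \<le> bump s w" by (simp add: bump_def)
      then show ?thesis using s2 by (intro mult_left_mono power_mono) (auto simp: K_def)
    qed
    finally show ?thesis .
  next
    case False
    then have "(\<Sum>x\<in>P. (bump r (w - c x))\<^sup>2) = 0"
      using r by (intro sum.neutral) (auto simp: dist_norm norm_minus_commute not_less intro!: bump_eq_0)
    then show ?thesis by (simp add: K_def)
  qed
  have clap: "continuous_on A (laplace_diff t \<phi>)" for A t by (rule continuous_on_laplace_diff[OF cont])
  have i1: "integrable lborel (\<lambda>w. (bump r (w - c x))\<^sup>2 * laplace_diff t \<phi> w)" for x t
  proof (rule integrable_continuous_support)
    fix w :: 'a assume "norm w > r + norm (c x)"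
    then have "norm (w - c x) \<ge> r" using norm_triangle_ineq2[of w "c x"] by simp
    then show "(bump r (w - c x))\<^sup>2 * laplace_diff t \<phi> w = 0" using r by (simp add: bump_eq_0)
  qed (intro continuous_intros clap)
  have i2: "integrable lborel (\<lambda>w. (bump s w)\<^sup>2 * laplace_diff t \<phi> w)" for t
    by (rule integrable_continuous_support[where r=s]) (use \<rho> in \<open>auto intro!: continuous_intros clap simp: bump_eq_0\<close>)
  have le: "(\<Sum>x\<in>P. LINT w|lborel. (bump r w)\<^sup>2 * laplace_diff t (\<lambda>w. \<phi> (c x + w)) w)
    \<le> K * (LINT w|lborel. (bump s w)\<^sup>2 * laplace_diff t \<phi> w)" for t
  proof -
    have "(LINT w|lborel. (bump r w)\<^sup>2 * laplace_diff t (\<lambda>w. \<phi> (c x + w)) w)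
      = (LINT w|lborel. (bump r (w - c x))\<^sup>2 * laplace_diff t \<phi> w)" for x
    proof -
      have "(LINT w|lborel. (bump r (c x + w - c x))\<^sup>2 * laplace_diff t \<phi> (c x + w))
        = (LINT w|lborel. (bump r (w - c x))\<^sup>2 * laplace_diff t \<phi> w)"
        using i1[of x t] by (intro lborel_integral_translate) auto
      then show ?thesis by (simp add: laplace_diff_def algebra_simps)
    qed
    then have "(\<Sum>x\<in>P. LINT w|lborel. (bump r w)\<^sup>2 * laplace_diff t (\<lambda>w. \<phi> (c x + w)) w)
      = (\<Sum>x\<in>P. LINT w|lborel. (bump r (w - c x))\<^sup>2 * laplace_diff t \<phi> w)" by simp
    also have "\<dots> = (LINT w|lborel. (\<Sum>x\<in>P. (bump r (w - c x))\<^sup>2 * laplace_diff t \<phi> w))"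
      by (rule Bochner_Integration.integral_sum[symmetric]) (rule i1)
    also have "\<dots> \<le> (LINT w|lborel. K * ((bump s w)\<^sup>2 * laplace_diff t \<phi> w))"
    proof (intro integral_mono Bochner_Integration.integrable_sum integrable_mult_right i1 i2)
      fix w
      show "(\<Sum>x\<in>P. (bump r (w - c x))\<^sup>2 * laplace_diff t \<phi> w) \<le> K * ((bump s w)\<^sup>2 * laplace_diff t \<phi> w)"
        using mult_right_mono[OF pw[of w] laplace_diff_nonneg[OF conv, of t w]]
        by (simp add: sum_distrib_right mult.assoc)
    qed
    finally show ?thesis by simp
  qed
  have "(\<lambda>n. \<Sum>x\<in>P. LINT w|lborel. (bump r w)\<^sup>2 * laplace_diff (1 / real (Suc n)) (\<lambda>w. \<phi> (c x + w)) w)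
    \<longlonglongrightarrow> (\<Sum>x\<in>P. 4 * flux (\<lambda>w. \<phi> (c x + w)) r)"
    by (intro tendsto_sum laplace_diff_bump_square_tendsto continuous_shift cont r)
  moreover have "(\<lambda>n. K * (LINT w|lborel. (bump s w)\<^sup>2 * laplace_diff (1 / real (Suc n)) \<phi> w)) \<longlonglongrightarrow> K * (4 * flux \<phi> s)"
    using \<rho> by (intro tendsto_mult tendsto_const laplace_diff_bump_square_tendsto cont) auto
  ultimately have "(\<Sum>x\<in>P. 4 * flux (\<lambda>w. \<phi> (c x + w)) r) \<le> K * (4 * flux \<phi> s)"
    by (rule LIMSEQ_le) (use le in auto)
  then have "4 * (\<Sum>x\<in>P. flux (\<lambda>w. \<phi> (c x + w)) r) \<le> 4 * (K * flux \<phi> s)"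
    by (simp add: sum_distrib_left mult.left_commute)
  then show ?thesis unfolding K_def by linarith
qed

text \<open>
  The numerical comparison behind the constant \<open>48\<close>: the left-hand side comes from the upper
  bound for the flux over the ball of radius \<open>\<rho> * (1 + 3 / d)\<close>, the last factor on the right
  from the lower bound over a small ball.  The left-hand side grows quadratically in
  \<open>d\<close>, because \<open>(1 + 3 / d) ^ d \<le> exp 3\<close>, up to the factor \<open>1 / d\<close> that both sides
  share; the right-hand side also grows exponentially.  The margin is small only for
  \<open>d = 1\<close>.
\<close>

lemma packing_constant_bound:
  assumes "d \<ge> 1"
  shows "162 / (real d + 3) * ((1 + 3 / real d) ^ (d + 3) * real d ^ 4 / (9 * (2 * real d + 3)\<^sup>2))
    \<le> 48 * (real d)\<^sup>2 * (11 / 12 * (3 / 2) ^ (d + 2) / (real d + 2))"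
proof -
  consider "d = 1" | "d = 2" | "d = 3" | "d = 4" | "d \<ge> 5" using assms by linarith
  then show ?thesis
  proof cases
    case 5
    define x where "x = real d"
    have x: "x \<ge> 5" using 5 by (simp add: x_def)
    have "(1 + 3 / x) ^ d \<le> exp 3"
      unfolding x_def using 5 by (intro exp_ge_one_plus_x_over_n_power_n) auto
    also have "exp 3 = exp (1::real) ^ 3" by (simp flip: exp_of_nat_mult)
    also have "\<dots> \<le> 3 ^ 3" by (intro power_mono exp_le) auto
    finally have e: "(1 + 3 / x) ^ d \<le> 27" by simp
    have "3 / x \<le> 3 / 5" using x by (intro divide_left_mono) auto
    then have "(1 + 3 / x) ^ 3 \<le> (8 / 5) ^ 3" using x by (intro power_mono) auto
    with e have "(1 + 3 / x) ^ (d + 3) \<le> 27 * (8 / 5) ^ 3"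
      unfolding power_add using x by (intro mult_mono) auto
    moreover have "x ^ 4 / (9 * (2 * x + 3)\<^sup>2) \<le> x\<^sup>2 / 36"
    proof -
      have "x ^ 4 / (9 * (2 * x + 3)\<^sup>2) \<le> x ^ 4 / (9 * (2 * x)\<^sup>2)"
        using x by (intro divide_left_mono mult_left_mono power_mono mult_pos_pos) auto
      also have "\<dots> = x\<^sup>2 / 36" using x by (simp add: power2_eq_square power4_eq_xxxx)
      finally show ?thesis .
    qed
    ultimately have prod: "(1 + 3 / x) ^ (d + 3) * (x ^ 4 / (9 * (2 * x + 3)\<^sup>2)) \<le> (27 * (8 / 5) ^ 3) * (x\<^sup>2 / 36)"
      by (rule mult_mono) (use x in auto)
    have "162 / (x + 3) \<le> 162 / (x + 2)" using x by (intro divide_left_mono) auto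
    then have "162 / (x + 3) * ((1 + 3 / x) ^ (d + 3) * (x ^ 4 / (9 * (2 * x + 3)\<^sup>2)))
       \<le> 162 / (x + 2) * ((27 * (8 / 5) ^ 3) * (x\<^sup>2 / 36))"
      by (rule mult_mono[OF _ prod]) (use x in auto)
    also have "\<dots> \<le> 44 * (3 / 2) ^ 7 * (x\<^sup>2 / (x + 2))"
      using x by (simp add: field_simps)
    also have "\<dots> \<le> 44 * (3 / 2) ^ (d + 2) * (x\<^sup>2 / (x + 2))"
      using x 5 by (intro mult_right_mono mult_left_mono power_increasing) auto
    also have "44 * p * (y / z) = 48 * y * (11 / 12 * p / z)" for p y z :: real by simp
    finally show ?thesis by (simp only: x_def times_divide_eq_right)
  qed (simp_all add: power_divide field_simps)
qed

text \<open>
  Around each point \<open>x\<close> of \<open>P\<close> there is a ball of radius \<open>3 * \<eta>\<close> with large flux.  Its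
  centre is less than \<open>\<eta>\<close> away from \<open>x\<close>, so the ball lies in \<open>ball x (4 * \<eta>)\<close>, and
  these balls are disjoint and contained in the ball of radius \<open>R + 4 * \<eta>\<close>.
\<close>

lemma Sigma_scale_separated_card:
  fixes \<phi> :: "'a::euclidean_space \<Rightarrow> real"
  assumes conv: "convex_on UNIV \<phi>" and lip: "L-lipschitz_on UNIV \<phi>"
    and pos: "R > 0" "\<alpha> > 0" "\<eta> > 0"
    and P: "finite P" "P \<subseteq> Sigma_scale \<phi> \<eta> \<alpha> \<inter> ball 0 R"
    and sep: "\<And>x y. x \<in> P \<Longrightarrow> y \<in> P \<Longrightarrow> x \<noteq> y \<Longrightarrow> dist x y \<ge> 8 * \<eta>"
  shows "real (card P) \<le> (48 * (real DIM('a))\<^sup>2 * (R + 4 * \<eta>) ^ (DIM('a) - 1)) * (L / (\<alpha> * \<eta> ^ (DIM('a) - 1)))"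
proof -
  define d where "d = DIM('a)"
  define x where "x = real d"
  define m where "m = d - 1"
  have d: "d = Suc m" "d \<ge> 1" by (auto simp: d_def m_def Suc_leI)
  have x: "x \<ge> 1" using d by (simp add: x_def)
  have cont: "continuous_on UNIV \<phi>" using lip by (rule lipschitz_on_continuous_on)
  have L: "L \<ge> 0" using lip by (rule lipschitz_on_nonneg)
  define \<rho> where "\<rho> = R + 4 * \<eta>"
  have \<rho>: "\<rho> > 0" using pos by (simp add: \<rho>_def)
  define \<omega> where "\<omega> = unit_ball_vol x"
  have \<omega>: "\<omega> > 0" using x by (simp add: \<omega>_def)
  define A where "A = 11 / 12 * (3 / 2) ^ (d + 2) / (x + 2)"
  define B where "B = 162 / (x + 3) * ((1 + 3 / x) ^ (d + 3) * x ^ 4 / (9 * (2 * x + 3)\<^sup>2))"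
  have A: "A > 0" using x by (simp add: A_def)
  \<comment> \<open>The diameter is a supremum that need not be attained, hence the detour through \<open>\<beta> < \<alpha>\<close>.\<close>
  have main: "real (card P) * \<beta> * \<eta> ^ m \<le> 48 * x\<^sup>2 * \<rho> ^ m * L" if \<beta>: "0 < \<beta>" "\<beta> < \<alpha>" for \<beta>
  proof -
    have "\<exists>c. dist c x < \<eta> \<and> flux (\<lambda>w. \<phi> (c + w)) (3 * \<eta>) \<ge> \<beta> * A * \<omega> * \<eta> ^ (m + 4)" if "x \<in> P" for x
    proof -
      have "\<beta> < diameter (subdifferential_on \<phi> (ball x \<eta>))"
        using that P \<beta> by (auto simp: Sigma_scale_def)
      then obtain p q where pq: "p \<in> subdifferential_on \<phi> (ball x \<eta>)" "q \<in> subdifferential_on \<phi> (ball x \<eta>)" "\<beta> < dist p q"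
        using diameter_bounded(2)[OF bounded_subdifferential_on[OF lip]] \<beta> by blast
      then obtain y z where yz: "y \<in> ball x \<eta>" "p \<in> subdifferential \<phi> y" "z \<in> ball x \<eta>" "q \<in> subdifferential \<phi> z"
        by (auto simp: subdifferential_on_def)
      have "dist y z \<le> 2 * \<eta>" using yz dist_triangle_less_add[of y x \<eta> z \<eta>] by (auto simp: dist_commute)
      then have "flux (\<lambda>w. \<phi> (midpoint y z + w)) (3 * \<eta>) \<ge> 11 / 12 * dist p q * \<eta> *
        ((3 / 2 * \<eta>)\<^sup>2 / (real DIM('a) + 2) * (unit_ball_vol (real DIM('a)) * (3 / 2 * \<eta>) ^ DIM('a)))"
        using pq \<beta> by (intro flux_ge_subgradients[OF conv cont pos(3) yz(2,4)]) auto
      also have "11 / 12 * dist p q * \<eta> *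
        ((3 / 2 * \<eta>)\<^sup>2 / (real DIM('a) + 2) * (unit_ball_vol (real DIM('a)) * (3 / 2 * \<eta>) ^ DIM('a)))
        = dist p q * (A * \<omega> * \<eta> ^ (m + 4))"
        unfolding d_def[symmetric] x_def[symmetric] A_def \<omega>_def
        by (simp add: d(1) power_mult_distrib power_add eval_nat_numeral mult_ac power_divide)
      finally have "flux (\<lambda>w. \<phi> (midpoint y z + w)) (3 * \<eta>) \<ge> dist p q * (A * \<omega> * \<eta> ^ (m + 4))" .
      moreover have "\<beta> * (A * \<omega> * \<eta> ^ (m + 4)) \<le> dist p q * (A * \<omega> * \<eta> ^ (m + 4))"
        using pq A \<omega> pos by (intro mult_right_mono) auto
      moreover have "dist (midpoint y z) x < \<eta>"
        using convex_ball[of x \<eta>] yz midpoint_in_closed_segment[of y z]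
        by (metis closed_segment_subset dist_commute mem_ball subsetD)
      ultimately show ?thesis by (intro exI[of _ "midpoint y z"]) (simp add: mult.assoc)
    qed
    then obtain c where c: "\<And>x. x \<in> P \<Longrightarrow> dist (c x) x < \<eta>"
      "\<And>x. x \<in> P \<Longrightarrow> flux (\<lambda>w. \<phi> (c x + w)) (3 * \<eta>) \<ge> \<beta> * A * \<omega> * \<eta> ^ (m + 4)"
      by metis
    have ball_sub: "ball (c x) (3 * \<eta>) \<subseteq> ball x (4 * \<eta>)" if "x \<in> P" for x
      using c(1)[OF that] by (simp add: ball_subset_ball_iff)
    \<comment> \<open>A radius close to \<open>\<rho>\<close> makes the large weight small on the ball of radius \<open>\<rho>\<close>, a large one
      costs the power \<open>d + 3\<close>; a relative gap of order \<open>1 / d\<close> balances the two.\<close>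
    define s where "s = \<rho> * (1 + 3 / x)"
    have s: "\<rho> < s" using \<rho> x by (simp add: s_def)
    have "real (card P) * (\<beta> * A * \<omega> * \<eta> ^ (m + 4)) \<le> (\<Sum>x\<in>P. flux (\<lambda>w. \<phi> (c x + w)) (3 * \<eta>))"
      using c(2) sum_bounded_below[of P "\<beta> * A * \<omega> * \<eta> ^ (m + 4)"] by simp
    also have "\<dots> \<le> (3 * \<eta>) ^ 4 / (s\<^sup>2 - \<rho>\<^sup>2)\<^sup>2 * flux \<phi> s"
    proof (rule sum_flux_le[OF conv cont P(1) _ \<rho> s])
      show "3 * \<eta> > 0" using pos by simp
      show "ball (c x) (3 * \<eta>) \<subseteq> ball 0 \<rho>" if "x \<in> P" for x
      proof -
        have "dist x 0 < R" using P that by (auto simp: dist_commute)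
        then have "ball x (4 * \<eta>) \<subseteq> ball 0 \<rho>" unfolding \<rho>_def by (simp add: ball_subset_ball_iff)
        then show ?thesis using ball_sub[OF that] by blast
      qed
      show "ball (c x) (3 * \<eta>) \<inter> ball (c y) (3 * \<eta>) = {}" if "x \<in> P" "y \<in> P" "x \<noteq> y" for x y
      proof -
        have "ball x (4 * \<eta>) \<inter> ball y (4 * \<eta>) = {}"
          using sep[OF that] by (intro disjoint_ballI) auto
        then show ?thesis using ball_sub[OF that(1)] ball_sub[OF that(2)] by blast
      qed
    qed
    also have "\<dots> \<le> (3 * \<eta>) ^ 4 / (s\<^sup>2 - \<rho>\<^sup>2)\<^sup>2 * (2 * L * \<omega> * s ^ (d + 3) / (x + 3))"
      using flux_le_lipschitz[OF lip, of s] s \<rho>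
      by (intro mult_left_mono) (auto simp: d_def x_def \<omega>_def)
    also have "\<dots> = B * L * \<rho> ^ m * (\<omega> * \<eta> ^ 4)"
    proof -
      have "s\<^sup>2 - \<rho>\<^sup>2 = \<rho>\<^sup>2 * (3 * (2 * x + 3) / x\<^sup>2)"
        using x by (simp add: s_def power2_eq_square field_simps)
      then have "(s\<^sup>2 - \<rho>\<^sup>2)\<^sup>2 = \<rho> ^ 4 * (9 * (2 * x + 3)\<^sup>2 / x ^ 4)"
        by (simp only: power_mult_distrib power_divide flip: power_mult) simp
      moreover have "s ^ (d + 3) = \<rho> ^ m * \<rho> ^ 4 * (1 + 3 / x) ^ (d + 3)"
        by (simp add: s_def power_mult_distrib d(1) flip: power_add) (simp add: eval_nat_numeral)
      ultimately show ?thesis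
        using \<rho> x by (simp add: B_def power_mult_distrib mult_ac)
    qed
    also have "\<dots> \<le> (48 * x\<^sup>2 * A) * L * \<rho> ^ m * (\<omega> * \<eta> ^ 4)"
      using packing_constant_bound[OF d(2)] L \<rho> \<omega> pos
      by (intro mult_right_mono) (auto simp: A_def B_def x_def)
    finally have "(real (card P) * \<beta> * \<eta> ^ m) * (A * \<omega> * \<eta> ^ 4) \<le> (48 * x\<^sup>2 * \<rho> ^ m * L) * (A * \<omega> * \<eta> ^ 4)"
      by (simp add: power_add mult_ac)
    then show ?thesis using A \<omega> pos by (subst (asm) mult_le_cancel_right_pos) auto
  qed
  have "real (card P) * \<alpha> * \<eta> ^ m \<le> 48 * x\<^sup>2 * \<rho> ^ m * L"
  proof (rule tendsto_upperbound)
    show "((\<lambda>\<beta>. real (card P) * \<beta> * \<eta> ^ m) \<longlongrightarrow> real (card P) * \<alpha> * \<eta> ^ m) (at_left \<alpha>)"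
      by (intro tendsto_intros)
    show "eventually (\<lambda>\<beta>. real (card P) * \<beta> * \<eta> ^ m \<le> 48 * x\<^sup>2 * \<rho> ^ m * L) (at_left \<alpha>)"
      using eventually_at_left_real[OF pos(2)] by eventually_elim (auto intro: main)
  qed simp
  then have "real (card P) \<le> 48 * x\<^sup>2 * \<rho> ^ m * L / (\<alpha> * \<eta> ^ m)"
    using pos by (simp add: pos_le_divide_eq mult.assoc)
  then show ?thesis by (simp add: x_def \<rho>_def m_def d_def)
qed

section \<open>Covering numbers and Hausdorff measure\<close>

text \<open>
  A \<open>\<delta>\<close>-separated set of maximal cardinality is the set of centres of a cover; the bound on
  the cardinalities makes the maximum exist.
\<close>

lemma covering_number_le_separated:
  fixes K :: "'a::metric_space set"
  assumes "\<delta> > 0"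
    and bound: "\<And>P. finite P \<Longrightarrow> P \<subseteq> K \<Longrightarrow> (\<And>x y. x \<in> P \<Longrightarrow> y \<in> P \<Longrightarrow> x \<noteq> y \<Longrightarrow> dist x y \<ge> \<delta>) \<Longrightarrow> real (card P) \<le> b"
  shows "real (covering_number K \<delta>) \<le> b"
proof -
  define S where "S P \<longleftrightarrow> finite P \<and> P \<subseteq> K \<and> (\<forall>x\<in>P. \<forall>y\<in>P. x \<noteq> y \<longrightarrow> dist x y \<ge> \<delta>)" for P
  have card: "real (card P) \<le> b" if "S P" for P
    using that by (intro bound) (auto simp: S_def)
  have "S {}" by (simp add: S_def)
  moreover have "\<forall>P. S P \<longrightarrow> card P < nat \<lfloor>b\<rfloor> + 1"
    using card by (auto simp: less_Suc_eq_le le_nat_floor)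
  ultimately obtain P where P: "S P" "\<And>Q. S Q \<Longrightarrow> card Q \<le> card P"
    using ex_has_greatest_nat[of S "{}" card "nat \<lfloor>b\<rfloor> + 1"] by blast
  have "K \<subseteq> (\<Union>x\<in>P. ball x \<delta>)"
  proof
    fix y assume y: "y \<in> K"
    show "y \<in> (\<Union>x\<in>P. ball x \<delta>)"
    proof (rule ccontr)
      assume "\<not> ?thesis"
      then have far: "dist x y \<ge> \<delta>" if "x \<in> P" for x using that by force
      then have "y \<notin> P" using assms(1) by force
      moreover have "S (insert y P)"
        using P(1) y far by (auto simp: S_def dist_commute)
      ultimately show False using P(2)[of "insert y P"] P(1) by (simp add: S_def)
    qed
  qed
  then have "covering_number K \<delta> \<le> card P"
    unfolding covering_number_def using P(1) by (intro Least_le) (auto simp: S_def)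
  then show ?thesis using card[OF P(1)] by linarith
qed

lemma lipschitz_on_Lip:
  assumes "L-lipschitz_on UNIV f"
  shows "(Lip f)-lipschitz_on UNIV f"
proof (rule lipschitz_onI)
  have ne: "{L. L-lipschitz_on UNIV f} \<noteq> {}" using assms by blast
  show "0 \<le> Lip f"
    unfolding Lip_def using ne by (intro cInf_greatest) (auto intro: lipschitz_on_nonneg)
  fix x y
  show "dist (f x) (f y) \<le> Lip f * dist x y"
  proof (cases "x = y")
    case False
    then have "dist (f x) (f y) / dist x y \<le> Lip f"
      unfolding Lip_def using ne
      by (intro cInf_greatest) (auto simp: pos_divide_le_eq intro: lipschitz_onD)
    then show ?thesis using False by (simp add: pos_divide_le_eq)
  qed simp
qed

lemma Sigma_set_subset_Sigma_scale:
  fixes f :: "'a::real_inner \<Rightarrow> real"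
  assumes "L-lipschitz_on UNIV f" and "\<eta> > 0"
  shows "Sigma_set f \<alpha> \<subseteq> Sigma_scale f \<eta> \<alpha>"
proof
  fix x assume "x \<in> Sigma_set f \<alpha>"
  moreover have "diameter (subdifferential f x) \<le> diameter (subdifferential_on f (ball x \<eta>))"
  proof (rule diameter_subset)
    show "subdifferential f x \<subseteq> subdifferential_on f (ball x \<eta>)"
      unfolding subdifferential_on_def using assms(2) by (intro UN_upper) simp
  qed (rule bounded_subdifferential_on[OF assms(1)])
  ultimately show "x \<in> Sigma_scale f \<eta> \<alpha>" by (simp add: Sigma_set_def Sigma_scale_def)
qed

lemma hausdorff_premeasure_le_covering_number:
  fixes A :: "'a::euclidean_space set"
  assumes "bounded A" and "0 < r" and "2 * r \<le> \<delta>"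
  shows "hausdorff_premeasure k \<delta> A \<le> ennreal (real (covering_number A r) * (unit_ball_vol (real k) * r ^ k))"
proof -
  obtain C where C: "finite C" "card C = covering_number A r" "A \<subseteq> (\<Union>x\<in>C. ball x r)"
    using covering_number_attained[OF assms(1,2)] by blast
  obtain h where h: "bij_betw h {..<card C} C"
    using ex_bij_betw_nat_finite[OF C(1)] by (auto simp: atLeast0LessThan)
  define U where "U i = (if i < card C then ball (h i) r else {})" for i
  have "A \<subseteq> (\<Union>i. U i)"
  proof
    fix a assume "a \<in> A"
    then obtain x where x: "x \<in> C" "a \<in> ball x r" using C by blast
    have "x \<in> h ` {..<card C}" using h x(1) by (simp add: bij_betw_def)
    then obtain i where "i < card C" "h i = x" by auto
    then show "a \<in> (\<Union>i. U i)" using x by (auto simp: U_def intro!: exI[of _ i])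
  qed
  moreover have "bounded (U i) \<and> diameter (U i) \<le> \<delta>" for i
    using assms by (simp add: U_def)
  ultimately have "hausdorff_premeasure k \<delta> A \<le> (\<Sum>i. hausdorff_weight k (U i))"
    unfolding hausdorff_premeasure_def by (intro Inf_lower) blast
  also have "\<dots> = (\<Sum>i<card C. hausdorff_weight k (U i))"
    by (rule suminf_finite) (auto simp: U_def hausdorff_weight_def)
  also have "\<dots> \<le> (\<Sum>i<card C. ennreal (unit_ball_vol (real k) * r ^ k))"
    using assms by (intro sum_mono) (simp add: U_def hausdorff_weight_def power_mult_distrib)
  also have "\<dots> = ennreal (real (covering_number A r) * (unit_ball_vol (real k) * r ^ k))"
    using assms by (simp add: C ennreal_mult flip: ennreal_of_nat_eq_real_of_nat)
  finally show ?thesis .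
qed

lemma covering_number_Sigma_scale_le:
  fixes \<phi> :: "'a::euclidean_space \<Rightarrow> real"
  assumes "convex_on UNIV \<phi>" and "\<exists>L. L-lipschitz_on UNIV \<phi>" and "R > 0" "\<alpha> > 0" "\<eta> > 0"
  shows "real (covering_number (Sigma_scale \<phi> \<eta> \<alpha> \<inter> ball 0 R) (8 * \<eta>))
    \<le> (48 * (real DIM('a))\<^sup>2 * (R + 4 * \<eta>) ^ (DIM('a) - 1)) * (Lip \<phi> / (\<alpha> * \<eta> ^ (DIM('a) - 1)))"
  using assms
  by (intro covering_number_le_separated Sigma_scale_separated_card) (auto intro: lipschitz_on_Lip)

lemma covering_number_mono:
  fixes A :: "'a::euclidean_space set"
  assumes "A \<subseteq> B" and "bounded B" and "\<delta> > 0"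
  shows "covering_number A \<delta> \<le> covering_number B \<delta>"
proof -
  obtain C where "finite C" "card C = covering_number B \<delta>" "B \<subseteq> (\<Union>x\<in>C. ball x \<delta>)"
    using covering_number_attained[OF assms(2,3)] by blast
  then show ?thesis
    using assms(1) unfolding covering_number_def[of A] by (intro Least_le exI[of _ C]) auto
qed

text \<open>
  The covering bound applies at every scale, and the factor \<open>\<eta> ^ (d - 1)\<close> in its denominator
  cancels against the weight of the balls of the cover.  Taking \<open>4 * \<eta> \<le> R\<close> replaces
  \<open>R + 4 * \<eta>\<close> by \<open>2 * R\<close>.
\<close>

lemma hausdorff_measure_Sigma_set_le:
  fixes \<phi> :: "'a::euclidean_space \<Rightarrow> real"
  assumes conv: "convex_on UNIV \<phi>" and lip: "\<exists>L. L-lipschitz_on UNIV \<phi>" and pos: "R > 0" "\<alpha> > 0"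
  shows "hausdorff_measure (DIM('a) - 1) (Sigma_set \<phi> \<alpha> \<inter> ball 0 R)
    \<le> ennreal (48 * (real DIM('a))\<^sup>2 * unit_ball_vol (real (DIM('a) - 1)) * 16 ^ (DIM('a) - 1)
        * (Lip \<phi> * R ^ (DIM('a) - 1) / \<alpha>))"
  unfolding hausdorff_measure_def
proof (rule SUP_least)
  fix \<delta> :: real assume "\<delta> \<in> {0<..}"
  then have \<delta>: "\<delta> > 0" by simp
  define m where "m = DIM('a) - 1"
  define \<omega> where "\<omega> = unit_ball_vol (real m)"
  define A where "A = Sigma_set \<phi> \<alpha> \<inter> ball 0 R"
  obtain L where L: "L-lipschitz_on UNIV \<phi>" using lip by blast
  have Lip: "Lip \<phi> \<ge> 0" using lipschitz_on_Lip[OF L] by (rule lipschitz_on_nonneg)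
  define \<eta> where "\<eta> = min (\<delta> / 16) (R / 4)"
  have \<eta>: "\<eta> > 0" "16 * \<eta> \<le> \<delta>" "4 * \<eta> \<le> R" using \<delta> pos by (auto simp: \<eta>_def)
  have "covering_number A (8 * \<eta>) \<le> covering_number (Sigma_scale \<phi> \<eta> \<alpha> \<inter> ball 0 R) (8 * \<eta>)"
    using Sigma_set_subset_Sigma_scale[OF L \<eta>(1)] \<eta>
    by (intro covering_number_mono bounded_Int) (auto simp: A_def)
  then have N: "real (covering_number A (8 * \<eta>))
    \<le> (48 * (real DIM('a))\<^sup>2 * (R + 4 * \<eta>) ^ m) * (Lip \<phi> / (\<alpha> * \<eta> ^ m))"
    using covering_number_Sigma_scale_le[OF conv lip pos \<eta>(1)] unfolding m_def by linarith
  have "hausdorff_premeasure m \<delta> A \<le> ennreal (real (covering_number A (8 * \<eta>)) * (\<omega> * (8 * \<eta>) ^ m))"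
    unfolding \<omega>_def using \<eta> by (intro hausdorff_premeasure_le_covering_number) (auto simp: A_def bounded_Int)
  also have "\<dots> \<le> ennreal (48 * (real DIM('a))\<^sup>2 * \<omega> * 16 ^ m * (Lip \<phi> * R ^ m / \<alpha>))"
  proof (rule ennreal_leI)
    have \<omega>: "\<omega> \<ge> 0" by (simp add: \<omega>_def)
    have "real (covering_number A (8 * \<eta>)) * (\<omega> * (8 * \<eta>) ^ m)
      \<le> (48 * (real DIM('a))\<^sup>2 * (R + 4 * \<eta>) ^ m) * (Lip \<phi> / (\<alpha> * \<eta> ^ m)) * (\<omega> * (8 * \<eta>) ^ m)"
      using N \<omega> \<eta> by (intro mult_right_mono) auto
    also have "\<dots> = 48 * (real DIM('a))\<^sup>2 * \<omega> * 8 ^ m * (Lip \<phi> / \<alpha>) * (R + 4 * \<eta>) ^ m"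
      using \<eta> by (simp add: power_mult_distrib)
    also have "\<dots> \<le> 48 * (real DIM('a))\<^sup>2 * \<omega> * 8 ^ m * (Lip \<phi> / \<alpha>) * (2 * R) ^ m"
      using \<eta> \<omega> pos Lip by (intro mult_left_mono power_mono) auto
    also have "\<dots> = 48 * (real DIM('a))\<^sup>2 * \<omega> * 16 ^ m * (Lip \<phi> * R ^ m / \<alpha>)"
    proof -
      have "(16::real) ^ m = 8 ^ m * 2 ^ m" by (simp flip: power_mult_distrib)
      then show ?thesis by (simp add: power_mult_distrib)
    qed
    finally show "real (covering_number A (8 * \<eta>)) * (\<omega> * (8 * \<eta>) ^ m) \<le> \<dots>" .
  qed
  finally show "hausdorff_premeasure (DIM('a) - 1) \<delta> (Sigma_set \<phi> \<alpha> \<inter> ball 0 R)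
    \<le> ennreal (48 * (real DIM('a))\<^sup>2 * unit_ball_vol (real (DIM('a) - 1)) * 16 ^ (DIM('a) - 1)
        * (Lip \<phi> * R ^ (DIM('a) - 1) / \<alpha>))"
    by (simp only: m_def A_def \<omega>_def)
qed

theorem theorem2p1:
  shows "(\<forall>\<phi> :: real ^ 'n \<Rightarrow> real. convex_on UNIV \<phi> \<longrightarrow> (\<exists>L. L-lipschitz_on UNIV \<phi>) \<longrightarrow>
            (\<forall>R>0. \<forall>\<alpha>>0. \<forall>\<eta>>0.
               real (covering_number (Sigma_scale \<phi> \<eta> \<alpha> \<inter> ball 0 R) (8 * \<eta>))
                 \<le> (48 * (real CARD('n))\<^sup>2 * (R + 4 * \<eta>) ^ (CARD('n) - 1))
                     * (Lip \<phi> / (\<alpha> * \<eta> ^ (CARD('n) - 1)))))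
       \<and> (\<exists>c::real. c > 0 \<and>
            (\<forall>\<phi> :: real ^ 'n \<Rightarrow> real. convex_on UNIV \<phi> \<longrightarrow> (\<exists>L. L-lipschitz_on UNIV \<phi>) \<longrightarrow>
               (\<forall>R>0. \<forall>\<alpha>>0.
                  hausdorff_measure (CARD('n) - 1) (Sigma_set \<phi> \<alpha> \<inter> ball 0 R)
                    \<le> ennreal (c * (Lip \<phi> * R ^ (CARD('n) - 1) / \<alpha>)))))"
proof (intro conjI)
  show "\<forall>\<phi> :: real ^ 'n \<Rightarrow> real. convex_on UNIV \<phi> \<longrightarrow> (\<exists>L. L-lipschitz_on UNIV \<phi>) \<longrightarrow>
            (\<forall>R>0. \<forall>\<alpha>>0. \<forall>\<eta>>0.
               real (covering_number (Sigma_scale \<phi> \<eta> \<alpha> \<inter> ball 0 R) (8 * \<eta>))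
                 \<le> (48 * (real CARD('n))\<^sup>2 * (R + 4 * \<eta>) ^ (CARD('n) - 1))
                     * (Lip \<phi> / (\<alpha> * \<eta> ^ (CARD('n) - 1))))"
    using covering_number_Sigma_scale_le[where ?'a = "real ^ 'n"] by simp
  let ?c = "48 * (real CARD('n))\<^sup>2 * unit_ball_vol (real (CARD('n) - 1)) * 16 ^ (CARD('n) - 1)"
  have "?c > 0" by simp
  moreover have "hausdorff_measure (CARD('n) - 1) (Sigma_set \<phi> \<alpha> \<inter> ball 0 R) \<le> ennreal (?c * (Lip \<phi> * R ^ (CARD('n) - 1) / \<alpha>))"
    if "convex_on UNIV \<phi>" "\<exists>L. L-lipschitz_on UNIV \<phi>" "R > 0" "\<alpha> > 0" for \<phi> :: "real ^ 'n \<Rightarrow> real" and R \<alpha>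
    using hausdorff_measure_Sigma_set_le[OF that] by simp
  ultimately show "\<exists>c::real. c > 0 \<and>
            (\<forall>\<phi> :: real ^ 'n \<Rightarrow> real. convex_on UNIV \<phi> \<longrightarrow> (\<exists>L. L-lipschitz_on UNIV \<phi>) \<longrightarrow>
               (\<forall>R>0. \<forall>\<alpha>>0.
                  hausdorff_measure (CARD('n) - 1) (Sigma_set \<phi> \<alpha> \<inter> ball 0 R)
                    \<le> ennreal (c * (Lip \<phi> * R ^ (CARD('n) - 1) / \<alpha>))))"
    by blast
qed

end
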